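(* Let $R$ be a UFD of characteristic $p>0$, $R[x,y]$ the polynomial ring, $0\ne a\in R$, $0\ne\theta(y)=\sum_{i\ge1}s_iy^i\in yR[y]$, $f:=ax+\theta(y)$, $0\ne F\in R[f]$, and $\phi\in\operatorname{Aut}_RR[x,y]$ given by $\phi(y)=y+aF$, $\phi(x)=x+a^{-1}(\theta(y)-\theta(y+aF))$. Define $d,b,\rho,\rho^p,q,q_1,q_2,\lambda$ as in the context, and let $\nu\in R[y_0,y_1]$ satisfy $(dF)^{p-1}=\nu(q,q_1)$. Let $\sigma:R[y_0,y_1,y_2]\to R[x,y]^{\phi}$ be the $R$-algebra homomorphism $y_0\mapsto q$, $y_1\mapsto q_1$, $y_2\mapsto q_2$, and $$\Lambda:=b^py_2+\rho^p(y_0)-y_1^p+b^{p-1}\lambda(y_0,y_1)\nu(y_0,y_1).$$ Then $\ker\sigma=(\Lambda)$. Consequently $R[x,y]^{\phi}$ is isomorphic to $R[y_0,y_1,y_2]/(\Lambda)$ as an $R$-algebra.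
   Context: $d:=\gcd(a,\theta'(y))\in R$ (gcd in $R[y]$ with the formal derivative), $b:=a/d$, $t_i:=s_i/d$ for $p\nmid i$, $\rho(y):=\sum_{p\nmid i}t_iy^i$, $\rho^p(T):=\sum_{p\nmid i}t_i^pT^i$, $\theta^*(y):=\sum_{i\ge1}s_{pi}y^i$, $q:=y^p-(aF)^{p-1}y$, $q_1:=d^{-1}(f-\theta^*(q))$, $\tilde q_1:=b^{1-p}(q_1^p-\rho^p(q))$; $\lambda(x,y)\in R[x,y]$ is a fixed polynomial with $\rho'(y)^py=\lambda(y^p,\rho(y))$ (such exists), and $q_2:=b^{-1}(\tilde q_1-\lambda(q,q_1)(dF)^{p-1})$. The elements $q,q_1,q_2$ lie in $R[x,y]^{\phi}:=\{u\mid\phi(u)=u\}$, and $f\in R[q,q_1]$, so $\nu$ exists. *)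

theory Defs
  imports "HOL-Computational_Algebra.Computational_Algebra"
begin

text \<open>Conventions.  R is the type 'a.
  R[y] = 'a poly.
  R[x,y] = 'a poly poly: the OUTER variable is x, the INNER variable is y.
  R[y0,y1,y2] = 'a poly poly poly: outer variable y0, middle y1, inner y2.\<close>

definition C2 :: "'a::comm_semiring_1 \<Rightarrow> 'a poly poly" where
  "C2 c = [:[:c:]:]"

definition C3 :: "'a::comm_semiring_1 \<Rightarrow> 'a poly poly poly" where
  "C3 c = [:[:[:c:]:]:]"

definition Xv :: "'a::comm_semiring_1 poly poly" where "Xv = [:0, 1:]"
definition Yv :: "'a::comm_semiring_1 poly poly" where "Yv = [:[:0, 1:]:]"

definition Y0 :: "'a::comm_semiring_1 poly poly poly" where "Y0 = [:0, 1:]"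
definition Y1 :: "'a::comm_semiring_1 poly poly poly" where "Y1 = [:[:0, 1:]:]"
definition Y2 :: "'a::comm_semiring_1 poly poly poly" where "Y2 = [:[:[:0, 1:]:]:]"

definition ev1 :: "('a::zero \<Rightarrow> 'b::comm_semiring_1) \<Rightarrow> 'a poly \<Rightarrow> 'b \<Rightarrow> 'b" where
  "ev1 emb g u = (\<Sum>i\<le>degree g. emb (coeff g i) * u ^ i)"

definition ev2 :: "('a::zero \<Rightarrow> 'b::comm_semiring_1) \<Rightarrow> 'a poly poly \<Rightarrow> 'b \<Rightarrow> 'b \<Rightarrow> 'b" where
  "ev2 emb g u v = ev1 (\<lambda>c. ev1 emb c v) g u"

definition ev3 :: "('a::zero \<Rightarrow> 'b::comm_semiring_1) \<Rightarrow> 'a poly poly poly \<Rightarrow> 'b \<Rightarrow> 'b \<Rightarrow> 'b \<Rightarrow> 'b" where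
  "ev3 emb g u0 u1 u2 = ev1 (\<lambda>c. ev2 emb c u1 u2) g u0"

text \<open>Coefficientwise (exact) division of an element of R[x,y] by r \<in> R, i.e. r^{-1} u.\<close>
definition divR :: "'a::{comm_semiring_1,divide} \<Rightarrow> 'a poly poly \<Rightarrow> 'a poly poly" where
  "divR r u = map_poly (map_poly (\<lambda>c. c div r)) u"

end

theory Submission
  imports Defs
begin

text \<open>
  The kernel and the image are handled by one statement: if \<open>\<pi>\<close> is zero or a prime divisor of \<open>a\<close> and
  \<open>\<sigma> g\<close> is divisible by \<open>\<pi>\<close>, then \<open>g\<close> lies in the ideal \<open>(\<Lambda>, \<pi>)\<close>. The case \<open>\<pi> = 0\<close> is the claim on the
  kernel. For the image, an invariant \<open>u\<close> satisfies \<open>a\<^sup>k u = \<Sum>\<^bsub>i<p\<^esub> g\<^sub>i y\<^sup>i\<close> with \<open>g\<^sub>i \<in> R[f, q]\<close>, and the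
  polynomial \<open>\<Sum> g\<^sub>i T\<^sup>i - a\<^sup>k u\<close> of degree less than \<open>p\<close> vanishes at the \<open>p\<close> points \<open>y + j a F\<close>, so
  \<open>a\<^sup>k u = g\<^sub>0\<close>; the prime factors of \<open>a\<^sup>k\<close> are then divided out one at a time by the statement above.

  If \<open>\<pi>\<close> does not divide \<open>b\<close>, then \<open>q\<close> and \<open>q\<^sub>1\<close> are algebraically independent modulo \<open>\<pi>\<close>, and
  pseudo-division by \<open>\<Lambda>\<close>, which is linear in \<open>y\<^sub>2\<close>, shows \<open>b\<^sup>N g \<in> (\<Lambda>, \<pi>)\<close>; the factor \<open>b\<close> can be cancelled since
  \<open>-\<Lambda>\<close> is monic in \<open>y\<^sub>1\<close> modulo \<open>b\<close>. If \<open>\<pi>\<close> divides \<open>b\<close>, then modulo \<open>\<pi>\<close> we have \<open>q = y\<^sup>p\<close>, \<open>q\<^sub>1 = \<rho>(y)\<close>, while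
  \<open>q\<^sub>2\<close> is monic of degree \<open>p\<close> in \<open>x\<close>. So it suffices that \<open>y\<^sub>1\<^sup>p - \<rho>\<^sup>p(y\<^sub>0)\<close> generates the relations between
  \<open>y\<^sup>p\<close> and \<open>\<rho>(y)\<close> modulo \<open>\<pi>\<close>, which holds because \<open>\<rho>'\<close> is nonzero modulo \<open>\<pi>\<close> by the choice of \<open>d\<close>.
\<close>

section \<open>Evaluation homomorphisms\<close>

text \<open>A predicate on plain functions, so that nested evaluations and \<open>\<phi>\<close>
  share one set of rewrite rules.\<close>

definition rhom :: "('a::comm_ring_1 \<Rightarrow> 'b::comm_ring_1) \<Rightarrow> bool" where
  "rhom h \<longleftrightarrow> h 0 = 0 \<and> h 1 = 1 \<and> (\<forall>x y. h (x + y) = h x + h y) \<and> (\<forall>x y. h (x * y) = h x * h y)"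

lemma rhomI:
  assumes "h 0 = 0" "h 1 = 1" "\<And>x y. h (x + y) = h x + h y" "\<And>x y. h (x * y) = h x * h y"
  shows "rhom h"
  using assms by (simp add: rhom_def)

lemma rhom_0: "rhom h \<Longrightarrow> h 0 = 0"
  and rhom_1: "rhom h \<Longrightarrow> h 1 = 1"
  and rhom_add: "rhom h \<Longrightarrow> h (x + y) = h x + h y"
  and rhom_mult: "rhom h \<Longrightarrow> h (x * y) = h x * h y"
  by (simp_all add: rhom_def)

lemma rhom_minus: assumes "rhom h" shows "h (- x) = - h x"
proof -
  have "h (- x) + h x = h (- x + x)" by (simp only: rhom_add[OF assms])
  then show ?thesis using rhom_0[OF assms] by (simp add: eq_neg_iff_add_eq_0)
qed

lemma rhom_diff: assumes "rhom h" shows "h (x - y) = h x - h y"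
  using rhom_add[OF assms, of x "- y"] rhom_minus[OF assms, of y] by simp

lemma rhom_power: assumes "rhom h" shows "h (x ^ n) = h x ^ n"
  by (induction n) (simp_all add: rhom_1[OF assms] rhom_mult[OF assms])

lemma rhom_sum: assumes "rhom h" shows "h (sum f A) = (\<Sum>i\<in>A. h (f i))"
  by (induction A rule: infinite_finite_induct) (simp_all add: rhom_0[OF assms] rhom_add[OF assms])

lemma rhom_of_nat: assumes "rhom h" shows "h (of_nat n) = of_nat n"
  by (induction n) (simp_all add: rhom_0[OF assms] rhom_1[OF assms] rhom_add[OF assms])

lemmas rhom_simps = rhom_0 rhom_1 rhom_add rhom_mult rhom_minus rhom_diff rhom_power rhom_sum rhom_of_nat

lemma rhom_dvd: "rhom h \<Longrightarrow> x dvd y \<Longrightarrow> h x dvd h y"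
  by (metis dvdE dvdI rhom_mult)

lemma rhom_const: "rhom (\<lambda>c. [:c:])"
  by (simp add: rhom_def)

lemma rhom_C2: "rhom C2"
  by (simp add: rhom_def C2_def one_pCons)

lemma rhom_C3: "rhom C3"
  by (simp add: rhom_def C3_def one_pCons)

lemma ev1_bound:
  assumes "emb 0 = 0" "degree g \<le> n"
  shows "ev1 emb g u = (\<Sum>i\<le>n. emb (coeff g i) * u ^ i)"
  unfolding ev1_def
  by (rule sum.mono_neutral_left) (use assms in \<open>auto simp: coeff_eq_0\<close>)

lemma ev1_pCons:
  assumes "emb 0 = 0"
  shows "ev1 emb (pCons c g) u = emb c + u * ev1 emb g u"
proof -
  have "ev1 emb (pCons c g) u = (\<Sum>i\<le>Suc (degree g). emb (coeff (pCons c g) i) * u ^ i)"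
    by (rule ev1_bound) (use assms degree_pCons_le in auto)
  also have "\<dots> = emb c + (\<Sum>i\<le>degree g. emb (coeff g i) * u ^ Suc i)"
    by (subst sum.atMost_Suc_shift) simp
  also have "(\<Sum>i\<le>degree g. emb (coeff g i) * u ^ Suc i) = u * ev1 emb g u"
    by (simp add: ev1_def sum_distrib_left mult_ac)
  finally show ?thesis .
qed

lemma ev1_0: "emb 0 = 0 \<Longrightarrow> ev1 emb 0 u = 0"
  by (simp add: ev1_def)

lemma ev1_const: "emb 0 = 0 \<Longrightarrow> ev1 emb [:c:] u = emb c"
  by (simp add: ev1_def)

lemma ev1_add:
  assumes "rhom emb" shows "ev1 emb (g + h) u = ev1 emb g u + ev1 emb h u"
proof (induction g h rule: poly_induct2)
  case 0 then show ?case by (simp add: ev1_0 rhom_0[OF assms])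
next
  case (pCons c g d h)
  then show ?case by (simp add: ev1_pCons rhom_simps[OF assms] algebra_simps)
qed

lemma ev1_smult:
  assumes "rhom emb" shows "ev1 emb (smult c g) u = emb c * ev1 emb g u"
  by (induction g) (simp_all add: ev1_0 ev1_pCons rhom_simps[OF assms] algebra_simps)

lemma ev1_mult:
  assumes "rhom emb" shows "ev1 emb (g * h) u = ev1 emb g u * ev1 emb h u"
  by (induction g)
    (simp_all add: ev1_0 ev1_pCons ev1_add[OF assms] ev1_smult[OF assms] rhom_simps[OF assms] algebra_simps)

lemma rhom_ev1: assumes "rhom emb" shows "rhom (\<lambda>g. ev1 emb g u)"
  by (rule rhomI)
    (simp_all add: ev1_0 ev1_add[OF assms] ev1_mult[OF assms] rhom_0[OF assms] rhom_1[OF assms] ev1_const one_pCons)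

lemma rhom_ev2: "rhom emb \<Longrightarrow> rhom (\<lambda>g. ev2 emb g u v)"
  unfolding ev2_def by (intro rhom_ev1)

lemma rhom_ev3: "rhom emb \<Longrightarrow> rhom (\<lambda>g. ev3 emb g u v w)"
  unfolding ev3_def by (intro rhom_ev1 rhom_ev2)

lemma ev1_X: assumes "rhom emb" shows "ev1 emb [:0, 1:] u = u"
  by (simp add: ev1_pCons ev1_0 rhom_0[OF assms] rhom_1[OF assms])

lemma rhom_ev1_comp: assumes "rhom h" shows "h (ev1 emb g u) = ev1 (\<lambda>c. h (emb c)) g (h u)"
  by (simp add: ev1_def rhom_simps[OF assms])

lemma rhom_ev2_comp: assumes "rhom h" shows "h (ev2 emb g u v) = ev2 (\<lambda>c. h (emb c)) g (h u) (h v)"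
  by (simp add: ev2_def rhom_ev1_comp[OF assms])

lemma rhom_ev3_comp: assumes "rhom h" shows "h (ev3 emb g u v w) = ev3 (\<lambda>c. h (emb c)) g (h u) (h v) (h w)"
  by (simp add: ev3_def rhom_ev1_comp[OF assms] rhom_ev2_comp[OF assms])

lemma ev2_C2: assumes "rhom emb" shows "ev2 emb (C2 c) u v = emb c"
  by (simp add: ev2_def C2_def ev1_const ev1_0 rhom_0[OF assms])

lemma ev2_Xv: "rhom emb \<Longrightarrow> ev2 emb Xv u v = u"
  unfolding ev2_def Xv_def by (intro ev1_X rhom_ev1)

lemma ev2_Yv: assumes "rhom emb" shows "ev2 emb Yv u v = v"
  by (simp add: ev2_def Yv_def ev1_const ev1_0 rhom_0[OF assms] ev1_X[OF assms])

lemma ev2_const: assumes "rhom emb" shows "ev2 emb [:c:] u v = ev1 emb c v"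
  by (simp add: ev2_def ev1_const ev1_0 rhom_0[OF assms])

lemma ev3_const: assumes "rhom emb" shows "ev3 emb [:c:] u v w = ev2 emb c v w"
  by (simp add: ev3_def ev2_def ev1_const ev1_0 rhom_0[OF assms])

lemma ev3_C3: "rhom emb \<Longrightarrow> ev3 emb (C3 c) u v w = emb c"
  using ev2_C2[of emb c v w] ev3_const[of emb "C2 c" u v w] by (simp add: C3_def C2_def)

lemma ev3_Y0: "rhom emb \<Longrightarrow> ev3 emb Y0 u v w = u"
  unfolding ev3_def Y0_def by (intro ev1_X rhom_ev2)

lemma ev3_Y1: "rhom emb \<Longrightarrow> ev3 emb Y1 u v w = v"
  using ev2_Xv[of emb v w] ev3_const[of emb Xv u v w] by (simp add: Y1_def Xv_def)

lemma ev3_Y2: "rhom emb \<Longrightarrow> ev3 emb Y2 u v w = w"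
  using ev2_Yv[of emb v w] ev3_const[of emb Yv u v w] by (simp add: Y2_def Yv_def)

lemma ev1_const_X: "ev1 (\<lambda>c. [:c:]) g [:0, 1:] = g"
  by (induction g) (simp_all add: ev1_0 ev1_pCons)

lemma ev1_C2_Yv: "ev1 C2 (g :: 'a::comm_ring_1 poly) Yv = [:g:]"
  using rhom_ev1_comp[OF rhom_const, of "\<lambda>c. [:c:]" g "[:0,1:]"]
  by (simp add: ev1_const_X C2_def[abs_def] Yv_def)

lemma ev2_C2_id: "ev2 C2 (g :: 'a::comm_ring_1 poly poly) Xv Yv = g"
  by (simp add: ev2_def ev1_C2_Yv ev1_const_X Xv_def)

lemma ev2_const_Y: "ev2 (\<lambda>c. [:C2 c:]) (g :: 'a::comm_ring_1 poly poly) [:Xv:] [:Yv:] = [:g:]"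
  using rhom_ev2_comp[OF rhom_const, of C2 g Xv Yv] by (simp add: ev2_C2_id)

lemma ev3_C3_id: "ev3 C3 (g :: 'a::comm_ring_1 poly poly poly) Y0 Y1 Y2 = g"
  by (simp add: ev3_def ev2_const_Y[unfolded C2_def Xv_def Yv_def] C3_def[abs_def] Y1_def Y2_def Y0_def ev1_const_X)

text \<open>Exchanging the variables lets either one be the outer variable, which is the one that
  degree and leading coefficient arguments see.\<close>

lemma ev2_swap:
  assumes "rhom emb" shows "ev2 emb (ev2 C2 g Yv Xv) u v = ev2 emb g v u"
  using rhom_ev2_comp[OF rhom_ev2[OF assms], of C2 g Yv Xv u v] assms by (simp add: ev2_C2 ev2_Xv ev2_Yv)

lemma ev3_swap:
  assumes "rhom emb" shows "ev3 emb (ev3 C3 g Y2 Y1 Y0) u v w = ev3 emb g w v u"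
  using rhom_ev3_comp[OF rhom_ev3[OF assms], of C3 g Y2 Y1 Y0 u v w] assms
  by (simp add: ev3_C3 ev3_Y0 ev3_Y1 ev3_Y2)

lemma ev2_swap_swap: "ev2 C2 (ev2 C2 (g :: 'a::comm_ring_1 poly poly) Yv Xv) Yv Xv = g"
  by (simp add: ev2_swap rhom_C2 ev2_C2_id)

lemma ev3_swap_swap: "ev3 C3 (ev3 C3 (g :: 'a::comm_ring_1 poly poly poly) Y2 Y1 Y0) Y2 Y1 Y0 = g"
  by (simp add: ev3_swap rhom_C3 ev3_C3_id)

section \<open>Divisibility by a prime element or zero\<close>

text \<open>This says that the quotient ring modulo \<pi> is an integral domain.\<close>

definition prime_or_zero :: "'a::comm_ring_1 \<Rightarrow> bool" where
  "prime_or_zero \<pi> \<longleftrightarrow> \<not> \<pi> dvd 1 \<and> (\<forall>x y. \<pi> dvd x * y \<longrightarrow> \<pi> dvd x \<or> \<pi> dvd y)"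

lemma prime_or_zero_iff: "prime_or_zero (\<pi>::'a::idom) \<longleftrightarrow> \<pi> = 0 \<or> prime_elem \<pi>"
  by (auto simp: prime_or_zero_def prime_elem_def)

lemma prime_or_zero_const: "prime_or_zero \<pi> \<Longrightarrow> prime_or_zero [:\<pi>::'a::idom:]"
  by (simp add: prime_or_zero_iff prime_elem_const_poly_iff)

lemma prime_or_zero_C3: "prime_or_zero \<pi> \<Longrightarrow> prime_or_zero (C3 (\<pi>::'a::idom))"
  by (simp add: C3_def prime_or_zero_const)

lemma prime_or_zero_power: "prime_or_zero \<pi> \<Longrightarrow> \<pi> dvd x ^ n \<Longrightarrow> \<pi> dvd x"
  by (induction n) (auto simp: prime_or_zero_def)

lemma ev1_cong_mod:
  fixes e :: "'b::comm_ring_1"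
  assumes "emb 0 = 0" "emb' 0 = 0" "\<And>c. e dvd emb c - emb' c" "e dvd u - u'"
  shows "e dvd ev1 emb g u - ev1 emb' g u'"
proof (induction g)
  case (pCons c g)
  have "ev1 emb (pCons c g) u - ev1 emb' (pCons c g) u'
      = (emb c - emb' c) + u * (ev1 emb g u - ev1 emb' g u') + (u - u') * ev1 emb' g u'"
    using assms(1,2) by (simp add: ev1_pCons algebra_simps)
  then show ?case using pCons assms(3,4) by simp
qed (simp add: ev1_0 assms)

lemma power_cong_mod: "e dvd u - (v::'a::comm_ring_1) \<Longrightarrow> e dvd u ^ n - v ^ n"
  by (simp add: power_diff_sumr2)

text \<open>Modulo \<pi> the element \<open>u\<close> has positive degree, and its leading
  coefficient is not a zero divisor. Its powers then have distinct degrees, so the top term of a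
  relation cannot cancel. For \<pi> = 0 this is ordinary transcendence.\<close>

lemma transcendental_mod:
  fixes \<pi> :: "'k::idom" and u u0 :: "'k poly" and emb :: "'c::zero \<Rightarrow> 'k poly"
  assumes \<pi>: "prime_or_zero \<pi>"
    and emb: "\<And>c. [:\<pi>:] dvd emb c - [:h c:]" "emb 0 = 0" "h 0 = 0"
    and u: "[:\<pi>:] dvd u - u0" "degree u0 > 0" "\<not> \<pi> dvd lead_coeff u0"
    and dv: "[:\<pi>:] dvd ev1 emb g u"
  shows "\<pi> dvd h (coeff g i)"
proof (rule ccontr)
  assume "\<not> \<pi> dvd h (coeff g i)"
  define M where "M = {i. \<not> \<pi> dvd h (coeff g i)}"
  have "M \<subseteq> {..degree g}"
    using emb(3) by (force simp: M_def intro: le_degree)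
  then have fin: "finite M" by (rule finite_subset) simp
  have ne: "M \<noteq> {}" using \<open>\<not> \<pi> dvd h (coeff g i)\<close> by (auto simp: M_def)
  define m where "m = Max M"
  have mM: "\<not> \<pi> dvd h (coeff g m)" using Max_in[OF fin ne] by (simp add: m_def M_def)
  have gt: "\<pi> dvd h (coeff g j)" if "j > m" for j
    using that Max_ge[OF fin, of j] by (force simp: m_def M_def)
  define n where "n = degree u0"
  have m_le: "m \<le> degree g" using \<open>M \<subseteq> _\<close> Max_in[OF fin ne] by (auto simp: m_def)
  have "[:\<pi>:] dvd ev1 emb g u - ev1 (\<lambda>c. [:h c:]) g u0"
    by (rule ev1_cong_mod) (use emb u in auto)
  then have "[:\<pi>:] dvd ev1 (\<lambda>c. [:h c:]) g u0"
    using dv by (metis dvd_diff_right_iff)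
  \<comment> \<open>In degree \<open>m * n\<close> only the index \<open>m\<close> survives modulo
    \<pi>: smaller powers of \<open>u0\<close> have too small a degree, and larger indices have
    coefficients divisible by \<pi>.\<close>
  then have "\<pi> dvd coeff (ev1 (\<lambda>c. [:h c:]) g u0) (m * n)"
    by (simp add: const_poly_dvd_iff)
  also have "coeff (ev1 (\<lambda>c. [:h c:]) g u0) (m * n) = (\<Sum>j\<le>degree g. h (coeff g j) * coeff (u0 ^ j) (m * n))"
    by (simp add: ev1_def coeff_sum)
  also have "\<dots> = h (coeff g m) * coeff (u0 ^ m) (m * n)
       + (\<Sum>j\<in>{..degree g} - {m}. h (coeff g j) * coeff (u0 ^ j) (m * n))"
    using m_le by (simp add: sum.remove)
  finally have "\<pi> dvd h (coeff g m) * coeff (u0 ^ m) (m * n)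
       + (\<Sum>j\<in>{..degree g} - {m}. h (coeff g j) * coeff (u0 ^ j) (m * n))" .
  moreover have "\<pi> dvd (\<Sum>j\<in>{..degree g} - {m}. h (coeff g j) * coeff (u0 ^ j) (m * n))"
  proof (rule dvd_sum)
    fix j assume "j \<in> {..degree g} - {m}"
    then consider "j < m" | "j > m" by force
    then show "\<pi> dvd h (coeff g j) * coeff (u0 ^ j) (m * n)"
    proof cases
      case 1
      have "degree (u0 ^ j) \<le> n * j" by (simp add: n_def degree_power_le)
      also have "\<dots> < m * n" using 1 u(2) by (simp add: n_def)
      finally show ?thesis by (simp add: coeff_eq_0)
    qed (simp add: gt)
  qed
  ultimately have "\<pi> dvd h (coeff g m) * coeff (u0 ^ m) (m * n)"
    by (simp add: dvd_add_left_iff)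
  moreover have "coeff (u0 ^ m) (m * n) = lead_coeff u0 ^ m"
    by (metis degree_power_eq lead_coeff_power mult.commute n_def degree_0 u(2) less_irrefl)
  ultimately have "\<pi> dvd lead_coeff u0 ^ m" using mM \<pi> by (auto simp: prime_or_zero_def)
  then show False using u(3) prime_or_zero_power[OF \<pi>] by blast
qed

section \<open>Division with remainder and clearing of denominators\<close>

lemma monic_division:
  fixes M :: "'k::idom poly"
  assumes "lead_coeff M = 1"
  obtains h r where "g = M * h + r" "r = 0 \<or> degree r < degree M"
proof -
  obtain h r where hr: "pseudo_divmod g M = (h, r)" by fastforce
  have "M \<noteq> 0" using assms by auto
  from pseudo_divmod[OF this hr] that[of h r] assms show ?thesis by simp
qed

lemma linear_pseudo_division:
  fixes g :: "'k::comm_ring_1 poly"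
  obtains N h g0 where "smult (c ^ N) g = [:P, c:] * h + [:g0:]"
proof -
  have "\<exists>N h g0. smult (c ^ N) g = [:P, c:] * h + [:g0:]"
  proof (induction g)
    case 0
    show ?case by (intro exI[of _ 0]) simp
  next
    case (pCons a g)
    then obtain N h g0 where *: "smult (c ^ N) g = [:P, c:] * h + [:g0:]" by blast
    have "smult (c ^ Suc N) (pCons a g) = [:c ^ Suc N * a:] + smult c ([:0, 1:] * smult (c ^ N) g)"
      by simp
    \<comment> \<open>The shifted remainder \<open>[:0, c * g0:]\<close> is
      \<open>[:P, c:] * [:g0:]\<close> minus the constant \<open>P * g0\<close>.\<close>
    also have "\<dots> = [:P, c:] * (smult c (pCons 0 h) + [:g0:]) + [:c ^ Suc N * a - P * g0:]"
      unfolding * by (simp add: algebra_simps smult_add_right)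
    finally show ?case by blast
  qed
  then show ?thesis using that by blast
qed

text \<open>As \<open>g' = 0\<close> forces \<open>g = 0\<close>, this transfers the independence of \<open>f\<close> to \<open>q\<^sub>1 = (f - \<theta>\<^sup>*(q)) / d\<close>.\<close>

lemma linear_substitution_denominators:
  fixes g :: "'k::comm_ring_1 poly"
  obtains N g' where "pcompose g' [:e, c:] = smult (c ^ N) g"
proof -
  have "\<exists>N g'. pcompose g' [:e, c:] = smult (c ^ N) g"
  proof (induction g)
    case 0
    show ?case by (intro exI[of _ 0]) simp
  next
    case (pCons a g)
    then obtain N g' where *: "pcompose g' [:e, c:] = smult (c ^ N) g" by blast
    \<comment> \<open>Composing \<open>[:- e, 1:]\<close> with \<open>[:e, c:]\<close> gives
      \<open>c\<close> times the variable, so each degree costs one factor \<open>c\<close>.\<close>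
    have "pcompose ([:c ^ Suc N * a:] + [:- e, 1:] * g') [:e, c:] = smult (c ^ Suc N) (pCons a g)"
      unfolding pcompose_add pcompose_mult * by (simp add: pcompose_pCons mult_ac)
    then show ?case by blast
  qed
  then show ?thesis using that by blast
qed

section \<open>Integers and derivatives in characteristic p\<close>

lemma of_nat_power_CHAR:
  assumes "CHAR('a::comm_semiring_1) = p" "prime p"
  shows "(of_nat i :: 'a) ^ p = of_nat i"
proof (induction i)
  case 0
  show ?case using prime_gt_0_nat[OF assms(2)] by (simp add: zero_power)
next
  case (Suc i)
  have "(of_nat i + 1 :: 'a) ^ p = of_nat i ^ p + 1 ^ p"
    by (rule freshmans_dream) (use assms in auto)
  then show ?case using Suc by (simp add: add.commute)
qed

text \<open>By Fermat's little theorem i to the power p - 1 is 1, so i is invertible although the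
  ring need not be a field.\<close>

lemma of_nat_is_unit:
  assumes "CHAR('a::idom) = p" "prime p" "\<not> p dvd i"
  shows "(of_nat i :: 'a) dvd 1"
proof -
  have "(of_nat i :: 'a) \<noteq> 0" using assms by (simp add: of_nat_eq_0_iff_char_dvd)
  moreover obtain k where k: "p = Suc k" using prime_gt_0_nat[OF assms(2)] by (cases p) auto
  moreover have "of_nat i * (of_nat i ^ k) = (of_nat i :: 'a) * 1"
    using of_nat_power_CHAR[OF assms(1,2), of i] k by simp
  ultimately have "(of_nat i :: 'a) ^ k = 1" by (simp only: mult_cancel_left) simp
  moreover have "k \<noteq> 0" using k assms(2) by (intro notI) simp
  ultimately show ?thesis by (metis dvd_power gr0I)
qed

text \<open>Chain rule without the terms from differentiating coefficients; it will be applied to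
  coefficients that are polynomials in \<open>y^p\<close>.\<close>

lemma pderiv_poly_constant_coeffs:
  assumes "\<And>i. pderiv (coeff H i) = 0"
  shows "pderiv (poly H \<rho>) = poly (pderiv H) \<rho> * pderiv (\<rho> :: 'a::idom poly)"
  using assms
proof (induction H)
  case (pCons c H)
  have "pderiv (coeff H i) = 0" for i using pCons.prems[of "Suc i"] by simp
  then have "pderiv (poly H \<rho>) = poly (pderiv H) \<rho> * pderiv \<rho>" by (rule pCons.IH)
  moreover have "pderiv c = 0" using pCons.prems[of 0] by simp
  ultimately show ?case by (simp add: pderiv_add pderiv_mult pderiv_pCons algebra_simps)
qed simp

text \<open>Differentiating a relation of degree \<open>n < p\<close> gives one of degree \<open>n - 1\<close> times \<open>\<rho>'\<close>.\<close>

lemma powers_independent_mod: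
  fixes \<rho> :: "'a::idom poly"
  assumes char: "CHAR('a) = p" "prime p" and r: "prime_or_zero r"
    and \<rho>: "\<not> [:r:] dvd pderiv \<rho>"
    and H: "degree H < p" "\<And>i. pderiv (coeff H i) = 0" "[:r:] dvd poly H \<rho>"
  shows "[:r:] dvd coeff H i"
proof -
  have "degree H < n \<Longrightarrow> n \<le> p \<Longrightarrow> \<forall>i. [:r:] dvd coeff H i" for n
    using H(2,3)
  proof (induction n arbitrary: H)
    case (Suc n)
    have *: "[:r:] dvd coeff H (Suc i)" for i
    \<comment> \<open>In the main case \<open>Suc i\<close> is a unit and the induction hypothesis
      applies to the derivative; otherwise the coefficient vanishes by degree.\<close>
    proof (cases "Suc i < p \<and> n > 0")
      case True
      have "[:r:] dvd pderiv (poly H \<rho>)"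
        using Suc.prems(4) by (auto simp: dvd_def pderiv_smult)
      then have "[:r:] dvd poly (pderiv H) \<rho>"
        using \<rho> prime_or_zero_const[OF r] pderiv_poly_constant_coeffs[of H \<rho>] Suc.prems(3)
        by (auto simp: prime_or_zero_def)
      moreover have "degree (pderiv H) < n"
        using Suc.prems(1) True
        by (intro degree_lessI) (auto simp: coeff_pderiv coeff_eq_0)
      moreover have "pderiv (coeff (pderiv H) i) = 0" for i
        by (simp add: coeff_pderiv pderiv_mult Suc.prems(3) pderiv_of_nat del: of_nat_Suc)
      ultimately have "[:r:] dvd coeff (pderiv H) i" using Suc.IH Suc.prems(2) by auto
      then have dv: "[:r:] dvd of_nat (Suc i) * coeff H (Suc i)" by (simp add: coeff_pderiv)
      have "\<not> p dvd Suc i" using True by (auto dest: dvd_imp_le)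
      then have "of_nat (Suc i) dvd (1 :: 'a poly)"
        using char by (intro of_nat_is_unit) auto
      then obtain k :: "'a poly" where k: "1 = of_nat (Suc i) * k" unfolding dvd_def by blast
      have "k * (of_nat (Suc i) * coeff H (Suc i)) = (of_nat (Suc i) * k) * coeff H (Suc i)"
        by (simp only: mult.assoc[symmetric] mult.commute[of k])
      also have "\<dots> = coeff H (Suc i)" by (simp only: k[symmetric] mult_1)
      finally have "coeff H (Suc i) = k * (of_nat (Suc i) * coeff H (Suc i))" by (rule sym)
      then show ?thesis using dv by (metis dvd_mult)
    next
      case False
      then have "degree H < Suc i" using Suc.prems(1,2) by auto
      then show ?thesis by (simp add: coeff_eq_0)
    qed
    obtain c H' where H': "H = pCons c H'" by (cases H) auto
    have "[:[:r:]:] dvd H'" using * by (simp add: H' const_poly_dvd_iff)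
    then have "[:r:] dvd poly H' \<rho>" by (auto simp: dvd_def)
    then have "[:r:] dvd \<rho> * poly H' \<rho>" by (rule dvd_mult)
    then have "[:r:] dvd c" using Suc.prems(4) by (metis H' poly_pCons dvd_add_left_iff)
    then show ?case using * by (auto simp: H' coeff_pCons split: nat.splits)
  qed simp
  then show ?thesis using H(1) by blast
qed

section \<open>Taylor expansions\<close>

lemma ev1_monom: "emb 0 = 0 \<Longrightarrow> ev1 emb (monom c n) u = emb c * u ^ n"
  by (induction n) (simp_all add: monom_0 monom_Suc ev1_const ev1_pCons ev1_0 mult_ac)

text \<open>The coefficients of \<open>g(y^p)\<close> at multiples of p are those of g, so
  divisibility of \<open>g(y^p)\<close> by a constant passes back to g.\<close>

lemma coeff_ev1_monom:
  assumes "p > 0"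
  shows "coeff (ev1 (\<lambda>c. [:c::'a::comm_ring_1:]) g (monom 1 p)) n = (if p dvd n then coeff g (n div p) else 0)"
proof (induction g arbitrary: n)
  case 0
  show ?case by (simp add: ev1_0)
next
  case (pCons c g)
  consider "n = 0" | "0 < n" "n < p" | "n \<ge> p" by linarith
  then show ?case
  proof cases
    case 1
    then show ?thesis using assms by (simp add: ev1_pCons coeff_monom_mult)
  next
    case 2
    then show ?thesis
      by (auto simp: ev1_pCons coeff_monom_mult coeff_pCons split: nat.splits dest: dvd_imp_le)
  next
    case 3
    then obtain k where k: "n = p + k" using le_Suc_ex by blast
    then show ?thesis using assms pCons.IH[of k]
      by (auto simp: ev1_pCons coeff_monom_mult coeff_pCons split: nat.splits)
  qed
qed

lemma C2_dvd_iff: "C2 (c :: 'a::idom) dvd g \<longleftrightarrow> (\<forall>i j. c dvd coeff (coeff g i) j)"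
  by (simp add: C2_def const_poly_dvd_iff)

lemma C2_mult: "C2 (x * y) = C2 x * C2 (y :: 'a::comm_ring_1)"
  by (rule rhom_mult[OF rhom_C2])

lemma C2_power: "C2 (x ^ n) = C2 (x :: 'a::comm_ring_1) ^ n"
  by (rule rhom_power[OF rhom_C2])

lemma C2_eq_0_iff: "C2 c = 0 \<longleftrightarrow> c = 0"
  by (simp add: C2_def)

text \<open>Coefficientwise \<open>div\<close> inverts multiplication only on actual multiples, so
  every use of \<open>divR\<close> needs an explicit factorisation first.\<close>

lemma divR_C2_mult:
  assumes "c \<noteq> (0::'a::idom_divide)" shows "divR c (C2 c * v) = v"
  unfolding divR_def
  by (intro poly_eqI) (use assms in \<open>simp add: coeff_map_poly C2_def\<close>)

lemma pderiv_sum: "pderiv (sum t I) = (\<Sum>i\<in>I. pderiv (t i :: 'a::idom poly))"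
  by (induction I rule: infinite_finite_induct) (simp_all add: pderiv_add)

definition subring_pred :: "('a::comm_ring_1 \<Rightarrow> bool) \<Rightarrow> bool" where
  "subring_pred M \<longleftrightarrow> M 0 \<and> M 1 \<and> (\<forall>x. M x \<longrightarrow> M (- x))
     \<and> (\<forall>x y. M x \<longrightarrow> M y \<longrightarrow> M (x + y)) \<and> (\<forall>x y. M x \<longrightarrow> M y \<longrightarrow> M (x * y))"

lemma subring_pred_0: "subring_pred M \<Longrightarrow> M 0"
  and subring_pred_1: "subring_pred M \<Longrightarrow> M 1"
  and subring_pred_minus: "subring_pred M \<Longrightarrow> M x \<Longrightarrow> M (- x)"
  and subring_pred_add: "subring_pred M \<Longrightarrow> M x \<Longrightarrow> M y \<Longrightarrow> M (x + y)"
  and subring_pred_mult: "subring_pred M \<Longrightarrow> M x \<Longrightarrow> M y \<Longrightarrow> M (x * y)"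
  by (simp_all add: subring_pred_def)

lemma subring_pred_diff: "subring_pred M \<Longrightarrow> M x \<Longrightarrow> M y \<Longrightarrow> M (x - y)"
  using subring_pred_add[of M x "- y"] subring_pred_minus[of M y] by simp

lemma subring_pred_power: "subring_pred M \<Longrightarrow> M x \<Longrightarrow> M (x ^ n)"
  by (induction n) (auto intro: subring_pred_1 subring_pred_mult)

lemma subring_pred_sum:
  assumes "subring_pred M" "\<And>i. i \<in> I \<Longrightarrow> M (t i)" shows "M (sum t I)"
  using assms(2) by (induction I rule: infinite_finite_induct) (auto intro: subring_pred_0 subring_pred_add assms(1))

lemmas subring_pred_intros =
  subring_pred_0 subring_pred_1 subring_pred_minus subring_pred_add subring_pred_mult subring_pred_diff subring_pred_power

lemma subring_pred_ev1:
  assumes "subring_pred M" "\<And>c. M (emb c)" "M u"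
  shows "M (ev1 emb g u)"
  unfolding ev1_def by (intro subring_pred_sum[OF assms(1)] subring_pred_intros[OF assms(1)] assms(2,3))

text \<open>The remainder is kept inside the subring \<open>M\<close>; this later shows that
  correction terms are free of x modulo \<open>a\<close>.\<close>

lemma ev1_taylor1:
  assumes emb: "emb 0 = 0" and M: "subring_pred M" "\<And>c. M (emb c)" "M u" "M v"
  obtains S where "M S" "ev1 emb g (u + v) = ev1 emb g u + v * S"
proof -
  have "\<exists>S. M S \<and> ev1 emb g (u + v) = ev1 emb g u + v * S"
  proof (induction g)
    case 0
    show ?case by (intro exI[of _ 0]) (simp add: ev1_0 emb subring_pred_0 M)
  next
    case (pCons c g)
    then obtain S where S: "M S" "ev1 emb g (u + v) = ev1 emb g u + v * S" by blast
    have "ev1 emb (pCons c g) (u + v) = ev1 emb (pCons c g) u + v * (ev1 emb g u + (u + v) * S)"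
      by (simp add: ev1_pCons emb S algebra_simps)
    moreover have "M (ev1 emb g u + (u + v) * S)"
      by (intro subring_pred_intros[OF M(1)] subring_pred_ev1[OF M(1)] S M)
    ultimately show ?case by blast
  qed
  then show ?thesis using that by blast
qed

lemma ev1_taylor2:
  assumes emb: "rhom emb" and M: "subring_pred M" "\<And>c. M (emb c)" "M u" "M v"
  obtains S where "M S" "ev1 emb g (u + v) = ev1 emb g u + v * ev1 emb (pderiv g) u + v\<^sup>2 * S"
proof -
  note emb0 = rhom_0[OF emb]
  have "\<exists>S. M S \<and> ev1 emb g (u + v) = ev1 emb g u + v * ev1 emb (pderiv g) u + v\<^sup>2 * S"
  proof (induction g)
    case 0
    show ?case by (intro exI[of _ 0]) (simp add: ev1_0 emb0 subring_pred_0 M)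
  next
    case (pCons c g)
    then obtain S where S: "M S"
      "ev1 emb g (u + v) = ev1 emb g u + v * ev1 emb (pderiv g) u + v\<^sup>2 * S" by blast
    have "ev1 emb (pCons c g) (u + v) = ev1 emb (pCons c g) u + v * ev1 emb (pderiv (pCons c g)) u
        + v\<^sup>2 * (ev1 emb (pderiv g) u + (u + v) * S)"
      by (simp add: ev1_pCons emb0 S pderiv_pCons ev1_add[OF emb] algebra_simps power2_eq_square)
    moreover have "M (ev1 emb (pderiv g) u + (u + v) * S)"
      by (intro subring_pred_intros[OF M(1)] subring_pred_ev1[OF M(1)] S M)
    ultimately show ?case by blast
  qed
  then show ?thesis using that by blast
qed

text \<open>Modulo the square of \<beta>, the difference is \<beta> times a polynomial of degree at
  most 1 in \<open>X\<close> over \<open>M\<close>. The term \<open>m3\<close> is unrestricted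
  because only the class modulo that square matters. Linearity in \<open>X\<close> is what keeps
  \<open>X^p\<close> the leading term of \<open>q2\<close>.\<close>

definition first_order :: "('a::comm_ring_1 \<Rightarrow> bool) \<Rightarrow> 'a \<Rightarrow> 'a \<Rightarrow> 'a \<Rightarrow> 'a \<Rightarrow> bool" where
  "first_order M \<beta> X x' x \<longleftrightarrow>
     M x \<and> (\<exists>m1 m2 m3. M m1 \<and> M m2 \<and> x' = x + \<beta> * (m1 + m2 * X + \<beta> * m3))"

lemma first_orderI:
  "M x \<Longrightarrow> M m1 \<Longrightarrow> M m2 \<Longrightarrow> x' = x + \<beta> * (m1 + m2 * X + \<beta> * m3) \<Longrightarrow> first_order M \<beta> X x' x"
  unfolding first_order_def by blast

lemma first_order_refl: "subring_pred M \<Longrightarrow> M x \<Longrightarrow> first_order M \<beta> X x x"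
  by (rule first_orderI[where ?m1.0 = 0 and ?m2.0 = 0 and ?m3.0 = 0]) (auto simp: subring_pred_def)

lemma first_order_add:
  assumes M: "subring_pred M" and x: "first_order M \<beta> X x' x" and y: "first_order M \<beta> X y' y"
  shows "first_order M \<beta> X (x' + y') (x + y)"
proof -
  obtain m1 m2 m3 where m: "M x" "M m1" "M m2" "x' = x + \<beta> * (m1 + m2 * X + \<beta> * m3)"
    using x by (auto simp: first_order_def)
  obtain n1 n2 n3 where n: "M y" "M n1" "M n2" "y' = y + \<beta> * (n1 + n2 * X + \<beta> * n3)"
    using y by (auto simp: first_order_def)
  show ?thesis
    by (rule first_orderI[where ?m1.0 = "m1 + n1" and ?m2.0 = "m2 + n2" and ?m3.0 = "m3 + n3"])
      (auto intro!: subring_pred_intros[OF M] m n simp: m(4) n(4) algebra_simps)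
qed

lemma first_order_mult:
  assumes M: "subring_pred M" and x: "first_order M \<beta> X x' x" and y: "first_order M \<beta> X y' y"
  shows "first_order M \<beta> X (x' * y') (x * y)"
proof -
  obtain m1 m2 m3 where m: "M x" "M m1" "M m2" "x' = x + \<beta> * (m1 + m2 * X + \<beta> * m3)"
    using x by (auto simp: first_order_def)
  obtain n1 n2 n3 where n: "M y" "M n1" "M n2" "y' = y + \<beta> * (n1 + n2 * X + \<beta> * n3)"
    using y by (auto simp: first_order_def)
  show ?thesis
    by (rule first_orderI[where ?m1.0 = "x * n1 + y * m1" and ?m2.0 = "x * n2 + y * m2"
          and ?m3.0 = "x * n3 + y * m3 + (m1 + m2 * X + \<beta> * m3) * (n1 + n2 * X + \<beta> * n3)"])
      (auto intro!: subring_pred_intros[OF M] m n simp: m(4) n(4) algebra_simps)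
qed

lemma first_order_ev1:
  assumes M: "subring_pred M" and emb: "\<And>c. first_order M \<beta> X (e' c) (e c)" "e' 0 = 0" "e 0 = 0"
    and u: "first_order M \<beta> X u' u"
  shows "first_order M \<beta> X (ev1 e' g u') (ev1 e g u)"
proof (induction g)
  case 0
  show ?case by (simp add: ev1_0 emb first_order_refl M subring_pred_0)
next
  case (pCons c g)
  then show ?case by (simp add: ev1_pCons emb first_order_add first_order_mult M u)
qed

lemma first_order_ev2:
  assumes M: "subring_pred M" and emb: "\<And>c. M (emb c)" "emb 0 = 0"
    and u: "first_order M \<beta> X u' u" and v: "first_order M \<beta> X v' v"
  shows "first_order M \<beta> X (ev2 emb g u' v') (ev2 emb g u v)"
  unfolding ev2_def
  by (intro first_order_ev1[OF M] first_order_refl[OF M] u v emb) (simp_all add: ev1_0 emb)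

lemma ev1_pcompose:
  assumes "rhom emb"
  shows "ev1 emb (pcompose g h) u = ev1 emb g (ev1 emb h u)"
  by (induction g)
    (simp_all add: pcompose_pCons ev1_0 ev1_const ev1_pCons rhom_0[OF assms] ev1_add[OF assms] ev1_mult[OF assms])

lemma ev1_map_poly: "emb 0 = 0 \<Longrightarrow> ev1 emb g u = poly (map_poly emb g) u"
  by (induction g) (simp_all add: ev1_0 ev1_pCons map_poly_pCons)

section \<open>Ideals generated by two constants\<close>

lemma smult_combination:
  assumes "\<And>n. \<exists>u v. coeff g n = x * u + y * v"
  obtains h k where "g = smult x h + smult y k"
proof -
  have "\<exists>h k. g = smult x h + smult y k"
    using assms
  proof (induction g)
    case 0
    show ?case by (intro exI[of _ 0]) simp
  next
    case (pCons c g)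
    obtain u v where uv: "c = x * u + y * v" using pCons.prems[of 0] by auto
    have "\<exists>u v. coeff g n = x * u + y * v" for n using pCons.prems[of "Suc n"] by simp
    then obtain h k where hk: "g = smult x h + smult y k" using pCons.IH by blast
    then have "pCons c g = smult x (pCons u h) + smult y (pCons v k)"
      by (simp add: uv)
    then show ?case by blast
  qed
  then show ?thesis using that by blast
qed

text \<open>A monic polynomial is not a zero divisor modulo (x, y). After reducing \<open>u\<close>
  and \<open>v\<close> modulo \<open>M\<close>, a multiple \<open>M * t\<close> would have degree
  below that of \<open>M\<close>, which forces \<open>t = 0\<close>.\<close>

lemma monic_cancel_combination:
  fixes M :: "'k::idom poly"
  assumes M: "lead_coeff M = 1" and eq: "M * s = smult x u + smult y v"
  obtains h k where "s = smult x h + smult y k"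
proof -
  obtain u1 u2 where u: "u = M * u1 + u2" "u2 = 0 \<or> degree u2 < degree M"
    by (rule monic_division[OF M])
  obtain v1 v2 where v: "v = M * v1 + v2" "v2 = 0 \<or> degree v2 < degree M"
    by (rule monic_division[OF M])
  define t where "t = s - (smult x u1 + smult y v1)"
  have t: "M * t = smult x u2 + smult y v2"
    using eq by (simp add: t_def u(1) v(1) algebra_simps smult_add_right)
  have "t = 0"
  proof (rule ccontr)
    assume "t \<noteq> 0"
    then have "degree M \<le> degree (M * t)" and nz: "M * t \<noteq> 0"
      using M leading_coeff_0_iff[of M] by (auto simp: degree_mult_eq)
    have "coeff (M * t) (degree (M * t)) = 0"
    proof -
      have "coeff u2 (degree (M * t)) = 0" "coeff v2 (degree (M * t)) = 0"
        using u(2) v(2) \<open>degree M \<le> _\<close> by (auto simp: coeff_eq_0)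
      then show ?thesis by (subst t) simp
    qed
    then show False using nz by simp
  qed
  then show ?thesis using that by (simp add: t_def)
qed

lemma ev2_cong_mod:
  fixes e :: "'b::comm_ring_1"
  assumes "emb 0 = 0" "e dvd u - u'" "e dvd v - v'"
  shows "e dvd ev2 emb g u v - ev2 emb g u' v'"
  unfolding ev2_def
  by (rule ev1_cong_mod) (use assms in \<open>auto simp: ev1_0 intro: ev1_cong_mod\<close>)

section \<open>The invariants and the expansion of \<open>q\<^sub>2\<close>\<close>

locale cyclic_action =
  fixes p :: nat
    and a b d :: "'a::factorial_ring_gcd"
    and \<theta> G :: "'a poly"
    and F lam \<nu> :: "'a poly poly"
  assumes charp: "CHAR('a) = p" and ppos: "p > 0"
    and a_nz: "a \<noteq> 0"
    and theta_0: "coeff \<theta> 0 = 0"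
    and F_nz: "F \<noteq> 0"
    and F_G: "F = ev1 C2 G (C2 a * Xv + ev1 C2 \<theta> Yv)"
    and a_eq: "a = b * d" and d_dvd2: "[:d:] dvd pderiv \<theta>"
    and d_gcd: "\<And>e. e dvd [:a:] \<Longrightarrow> e dvd pderiv \<theta> \<Longrightarrow> e dvd [:d:]"
begin

definition "f = C2 a * Xv + ev1 C2 \<theta> Yv"
definition "\<rho> = (\<Sum>i\<le>degree \<theta>. if p dvd i then 0 else monom (coeff \<theta> i div d) i)"
definition "\<rho>p = (\<Sum>i\<le>degree \<theta>. if p dvd i then 0 else monom ((coeff \<theta> i div d) ^ p) i)"
definition "\<theta>s = (\<Sum>i\<in>{1..degree \<theta>}. monom (coeff \<theta> (p * i)) i)"
definition "\<phi>y = Yv + C2 a * F"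
definition "\<phi>x = Xv + divR a (ev1 C2 \<theta> Yv - ev1 C2 \<theta> (Yv + C2 a * F))"
definition "\<phi> = (\<lambda>u. ev2 C2 u \<phi>x \<phi>y)"
definition "q = Yv ^ p - (C2 a * F) ^ (p - 1) * Yv"
definition "q1 = divR d (f - ev1 C2 \<theta>s q)"
definition "q1t = divR (b ^ (p - 1)) (q1 ^ p - ev1 C2 \<rho>p q)"
definition "q2 = divR b (q1t - ev2 C2 lam q q1 * (C2 d * F) ^ (p - 1))"

lemma prime_p: "prime p"
  using prime_CHAR_semidom[where 'a = 'a] charp ppos by simp

lemma p_ge_2: "p \<ge> 2"
  using prime_p by (rule prime_ge_2_nat)

lemma char_poly: "CHAR('a poly) = p" "CHAR('a poly poly) = p"
  using charp by simp_all

lemma d_nz: "d \<noteq> 0"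
  using a_eq a_nz by auto

lemma C2_a: "C2 a = C2 b * C2 d"
  unfolding a_eq by (rule C2_mult)

lemma b_nz: "b \<noteq> 0"
  using a_eq a_nz by auto

lemma f_eq: "f = C2 a * Xv + [:\<theta>:]"
  by (simp add: f_def ev1_C2_Yv)

lemma F_eq: "F = ev1 C2 G f"
  using F_G by (simp add: f_def)

text \<open>The derivative only gives that d divides i times the coefficient; i is a unit
  here.\<close>

lemma d_dvd_coeff:
  assumes "\<not> p dvd i" shows "d dvd coeff \<theta> i"
proof -
  obtain j where j: "i = Suc j" using assms by (cases i) auto
  have "d dvd of_nat i * coeff \<theta> i"
    using d_dvd2 by (simp add: const_poly_dvd_iff coeff_pderiv j)
  then show ?thesis
    using of_nat_is_unit[OF charp prime_p assms] by (simp add: dvd_mult_unit_iff' mult.commute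
      dvd_mult_unit_iff)
qed

lemma coeff_\<rho>: "coeff \<rho> i = (if p dvd i then 0 else coeff \<theta> i div d)"
proof -
  have "coeff \<rho> i = (\<Sum>j\<le>degree \<theta>. if j = i then (if p dvd i then 0 else coeff \<theta> i div d) else 0)"
    unfolding \<rho>_def coeff_sum by (intro sum.cong) auto
  also have "\<dots> = (if p dvd i then 0 else coeff \<theta> i div d)"
    by (auto simp: coeff_eq_0 not_le)
  finally show ?thesis .
qed

lemma coeff_\<theta>s: "coeff \<theta>s i = coeff \<theta> (p * i)"
proof -
  have "coeff \<theta>s i = (\<Sum>j\<in>{1..degree \<theta>}. if j = i then coeff \<theta> (p * i) else 0)"
    unfolding \<theta>s_def coeff_sum by (intro sum.cong) auto
  also have "\<dots> = coeff \<theta> (p * i)"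
  proof (cases "i \<le> degree \<theta>")
    case False
    moreover have "i \<le> p * i" using ppos by simp
    ultimately have "degree \<theta> < p * i" by linarith
    then show ?thesis using False by (simp add: coeff_eq_0)
  \<comment> \<open>The sum starts at 1, so index 0 is right only because the constant term of
    \<theta> is zero.\<close>
  qed (cases i; simp add: theta_0)
  finally show ?thesis .
qed

text \<open>The exponents divisible by p form a polynomial in \<open>y^p\<close>; all other
  coefficients are multiples of \<open>d\<close>.\<close>

lemma \<theta>_decomp: "\<theta> = ev1 (\<lambda>c. [:c:]) \<theta>s (monom 1 p) + smult d \<rho>"
  by (rule poly_eqI) (use ppos d_dvd_coeff in \<open>auto simp: coeff_ev1_monom coeff_\<rho> coeff_\<theta>s\<close>)

lemma Yv_power: "Yv ^ n = [:monom 1 n:]"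
  by (induction n) (simp_all add: Yv_def monom_0 monom_Suc one_pCons)

lemma const_ev1_power_p: "[:ev1 (\<lambda>c. [:c:]) g (monom 1 p):] = ev1 C2 (g :: 'a poly) (Yv ^ p)"
  using rhom_ev1_comp[OF rhom_const, of "\<lambda>c. [:c:]" g "monom 1 p"]
  by (simp add: Yv_power C2_def[abs_def])

lemma \<rho>_power: "\<rho> ^ p = ev1 (\<lambda>c. [:c:]) \<rho>p (monom 1 p)"
proof -
  have "\<rho> ^ p = (\<Sum>i\<le>degree \<theta>. (if p dvd i then 0 else monom (coeff \<theta> i div d) i) ^ p)"
    unfolding \<rho>_def by (rule freshmans_dream_sum) (use prime_p char_poly in auto)
  also have "\<dots> = ev1 (\<lambda>c. [:c:]) \<rho>p (monom 1 p)"
    unfolding \<rho>p_def rhom_sum[OF rhom_ev1[OF rhom_const]]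
    using ppos by (intro sum.cong) (auto simp: ev1_0 ev1_monom monom_power smult_monom mult.commute zero_power)
  finally show ?thesis .
qed

text \<open>Frobenius acts termwise, and the integer factors from differentiation are fixed because
  \<open>i^p = i\<close>.\<close>

lemma pderiv_\<rho>_power: "pderiv \<rho> ^ p = ev1 (\<lambda>c. [:c:]) (pderiv \<rho>p) (monom 1 p)"
proof -
  have "pderiv \<rho> ^ p = (\<Sum>i\<le>degree \<theta>. (if p dvd i then 0 else pderiv (monom (coeff \<theta> i div d) i)) ^ p)"
    unfolding \<rho>_def pderiv_sum
    by (subst freshmans_dream_sum) (use prime_p char_poly in \<open>auto intro!: sum.cong\<close>)
  also have "\<dots> = ev1 (\<lambda>c. [:c:]) (pderiv \<rho>p) (monom 1 p)"
    unfolding \<rho>p_def pderiv_sum rhom_sum[OF rhom_ev1[OF rhom_const]]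
    using ppos of_nat_power_CHAR[OF charp prime_p]
    by (intro sum.cong) (auto simp: pderiv_monom ev1_0 ev1_monom monom_power smult_monom mult.commute zero_power
        power_mult_distrib)
  finally show ?thesis .
qed

text \<open>The class of \<open>w\<close> modulo \<open>a\<close> does not involve x, since
  \<open>[:v:]\<close> is a polynomial in the inner variable y alone.\<close>

definition y_mod_a :: "'a poly poly \<Rightarrow> bool" where
  "y_mod_a w \<longleftrightarrow> (\<exists>v. C2 a dvd w - [:v:])"

lemma y_mod_aI: "C2 a dvd w - [:v:] \<Longrightarrow> y_mod_a w"
  by (auto simp: y_mod_a_def)

lemma y_mod_a_const: "y_mod_a [:v:]"
  by (rule y_mod_aI[of _ v]) simp

lemma y_mod_a_C2: "y_mod_a (C2 c)"
  by (simp add: C2_def y_mod_a_const)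

lemma y_mod_a_Yv: "y_mod_a Yv"
  by (simp add: Yv_def y_mod_a_const)

lemma subring_y_mod_a: "subring_pred y_mod_a"
  unfolding subring_pred_def
proof (intro conjI allI impI)
  show "y_mod_a 0" using y_mod_a_const[of 0] by simp
  show "y_mod_a 1" using y_mod_a_const[of 1] by (simp add: one_pCons)
next
  fix x assume "y_mod_a x"
  then obtain v where "C2 a dvd x - [:v:]" by (auto simp: y_mod_a_def)
  then have "C2 a dvd - (x - [:v:])" by (subst dvd_minus_iff)
  moreover have "- (x - [:v:]) = - x - [:- v:]" by simp
  ultimately show "y_mod_a (- x)" by (metis y_mod_aI)
next
  fix x y assume "y_mod_a x" "y_mod_a y"
  then obtain v w where vw: "C2 a dvd x - [:v:]" "C2 a dvd y - [:w:]" by (auto simp: y_mod_a_def)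
  have "C2 a dvd (x - [:v:]) + (y - [:w:])" using vw by (rule dvd_add)
  moreover have "(x - [:v:]) + (y - [:w:]) = x + y - [:v + w:]" by simp
  ultimately show "y_mod_a (x + y)" by (metis y_mod_aI)
  have "C2 a dvd (x - [:v:]) * y + [:v:] * (y - [:w:])"
    by (intro dvd_add dvd_mult2[OF vw(1)] dvd_mult[OF vw(2)])
  moreover have "(x - [:v:]) * y + [:v:] * (y - [:w:]) = x * y - [:v * w:]"
    by (simp add: algebra_simps)
  ultimately show "y_mod_a (x * y)" by (metis y_mod_aI)
qed

lemmas y_mod_a_intros = subring_pred_intros[OF subring_y_mod_a] y_mod_a_const y_mod_a_C2 y_mod_a_Yv

lemma y_mod_a_f: "y_mod_a f"
  by (rule y_mod_aI[of _ \<theta>]) (simp add: f_eq)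

lemma y_mod_a_F: "y_mod_a F"
  unfolding F_eq by (intro subring_pred_ev1[OF subring_y_mod_a] y_mod_a_C2 y_mod_a_f)

text \<open>Here \<open>\<theta>\<^sup>*(y\<^sup>p) = \<theta>\<^sup>*(q) + z S\<close> with \<open>z = y\<^sup>p - q = a Z\<close>, so that \<open>q\<^sub>1 = b X + \<rho>(y)\<close> for \<open>X = x + Z S\<close>.\<close>

definition "z = (C2 a * F) ^ (p - 1) * Yv"
definition "Z = C2 a ^ (p - 2) * F ^ (p - 1) * Yv"

lemma q_eq: "q = Yv ^ p - z"
  by (simp add: q_def z_def)

lemma z_eq: "z = C2 a * Z"
proof -
  have "p - 1 = Suc (p - 2)" using p_ge_2 by simp
  then show ?thesis by (simp add: z_def Z_def power_mult_distrib)
qed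

lemma z_eq': "z = C2 (b ^ (p - 1)) * ((C2 d * F) ^ (p - 1) * Yv)"
  by (simp add: z_def C2_a C2_power power_mult_distrib mult_ac)

lemma y_mod_a_Z: "y_mod_a Z"
  unfolding Z_def by (intro y_mod_a_intros y_mod_a_F)

lemma y_mod_a_z: "y_mod_a z"
  unfolding z_eq by (intro y_mod_a_intros y_mod_a_Z)

lemma y_mod_a_q: "y_mod_a q"
  unfolding q_eq by (intro y_mod_a_intros y_mod_a_z)

text \<open>A Taylor remainder is chosen once and for all, so that \<open>X\<close> is a fixed
  element throughout.\<close>

definition "S = (SOME S. y_mod_a S \<and> ev1 C2 \<theta>s (Yv ^ p) = ev1 C2 \<theta>s q + z * S)"
definition "X = Xv + Z * S"

lemma S: "y_mod_a S" "ev1 C2 \<theta>s (Yv ^ p) = ev1 C2 \<theta>s q + z * S"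
proof -
  obtain T where "y_mod_a T" "ev1 C2 \<theta>s (q + z) = ev1 C2 \<theta>s q + z * T"
    by (rule ev1_taylor1[of C2 y_mod_a q z \<theta>s])
      (auto intro: y_mod_a_C2 y_mod_a_q y_mod_a_z subring_y_mod_a simp: rhom_0[OF rhom_C2])
  then have "\<exists>S. y_mod_a S \<and> ev1 C2 \<theta>s (Yv ^ p) = ev1 C2 \<theta>s q + z * S"
    by (intro exI[of _ T]) (simp add: q_eq)
  from someI_ex[OF this] show "y_mod_a S" "ev1 C2 \<theta>s (Yv ^ p) = ev1 C2 \<theta>s q + z * S"
    by (simp_all add: S_def)
qed

lemma f_minus: "f - ev1 C2 \<theta>s q = C2 d * (C2 b * X + [:\<rho>:])"
proof -
  have "[:\<theta>:] = ev1 C2 \<theta>s (Yv ^ p) + C2 d * [:\<rho>:]"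
    by (subst \<theta>_decomp) (simp add: C2_def flip: const_ev1_power_p)
  then show ?thesis
    by (simp add: f_eq S z_eq X_def C2_a algebra_simps)
qed

lemma q1_eq: "q1 = C2 b * X + [:\<rho>:]"
  unfolding q1_def f_minus by (rule divR_C2_mult[OF d_nz])

lemma d_q1: "C2 d * q1 = f - ev1 C2 \<theta>s q"
  by (simp add: q1_eq f_minus)

definition "w = (C2 d * F) ^ (p - 1)"

lemma y_mod_a_w: "y_mod_a w"
  unfolding w_def by (intro y_mod_a_intros y_mod_a_F)

text \<open>Frobenius splits \<open>q1^p\<close> into \<open>b^p X^p\<close> and
  \<open>\<rho>p\<close> at \<open>y^p\<close>. Expanding \<open>\<rho>p\<close> at
  \<open>q = y^p - z\<close> to second order, with \<open>z = b^(p-1) w y\<close>, makes every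
  remaining term divisible by \<open>b^(p-1)\<close>.\<close>

lemma q1_power_minus:
  obtains S2 where "y_mod_a S2" "q1 ^ p - ev1 C2 \<rho>p q
    = C2 (b ^ (p - 1)) * (C2 b * X ^ p + w * Yv * [:pderiv \<rho>:] ^ p - C2 (b ^ (p - 1)) * w\<^sup>2 * Yv\<^sup>2 * S2)"
proof (rule ev1_taylor2[OF rhom_C2 subring_y_mod_a y_mod_a_C2, of "Yv ^ p" "- z" \<rho>p])
  show "y_mod_a (Yv ^ p)" "y_mod_a (- z)" by (intro y_mod_a_intros y_mod_a_z)+
  fix S2 assume S2: "y_mod_a S2"
    "ev1 C2 \<rho>p (Yv ^ p + - z) = ev1 C2 \<rho>p (Yv ^ p) + - z * ev1 C2 (pderiv \<rho>p) (Yv ^ p) + (- z)\<^sup>2 * S2"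
  have "q1 ^ p = (C2 b * X) ^ p + [:\<rho>:] ^ p"
    unfolding q1_eq by (rule freshmans_dream) (use prime_p char_poly in auto)
  also have "[:\<rho>:] ^ p = ev1 C2 \<rho>p (Yv ^ p)"
    by (simp only: const_ev1_power_p[symmetric] \<rho>_power[symmetric] rhom_power[OF rhom_const])
  finally have q1p: "q1 ^ p = C2 b ^ p * X ^ p + ev1 C2 \<rho>p (Yv ^ p)"
    by (simp add: power_mult_distrib)
  have der: "ev1 C2 (pderiv \<rho>p) (Yv ^ p) = [:pderiv \<rho>:] ^ p"
    by (simp only: const_ev1_power_p[symmetric] pderiv_\<rho>_power[symmetric] rhom_power[OF rhom_const])
  have bp: "C2 b ^ p = C2 b ^ (p - 1) * C2 b"
    using ppos by (metis power_minus_mult)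
  have "q1 ^ p - ev1 C2 \<rho>p q = C2 b ^ p * X ^ p + z * [:pderiv \<rho>:] ^ p - z\<^sup>2 * S2"
    using S2(2) by (simp add: q1p q_eq der)
  also have "\<dots> = C2 (b ^ (p - 1)) * (C2 b * X ^ p + w * Yv * [:pderiv \<rho>:] ^ p
      - C2 (b ^ (p - 1)) * w\<^sup>2 * Yv\<^sup>2 * S2)"
    unfolding z_eq'[folded w_def] C2_power bp by (simp add: power2_eq_square algebra_simps)
  finally show thesis using S2(1) that by blast
qed

lemma b_power_nz: "b ^ n \<noteq> 0"
  using b_nz by simp

lemma q1t: "C2 (b ^ (p - 1)) * q1t = q1 ^ p - ev1 C2 \<rho>p q"
proof (rule q1_power_minus)
  fix S2
  assume *: "q1 ^ p - ev1 C2 \<rho>p q = C2 (b ^ (p - 1)) * (C2 b * X ^ p + w * Yv * [:pderiv \<rho>:] ^ p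
    - C2 (b ^ (p - 1)) * w\<^sup>2 * Yv\<^sup>2 * S2)"
  show ?thesis unfolding q1t_def * divR_C2_mult[OF b_power_nz] ..
qed

end

text \<open>A second locale, because these equations refer to \<open>\<rho>\<close>,
  \<open>q\<close>, \<open>q1\<close> and \<open>w\<close>.\<close>

locale cyclic_action_lambda = cyclic_action +
  assumes lambda_eq: "ev2 (\<lambda>c. [:c:]) lam (monom 1 p) \<rho> = (pderiv \<rho>) ^ p * [:0, 1:]"
    and nu_eq: "w = ev2 C2 \<nu> q q1"
begin

text \<open>To first order in \<open>b\<close>, \<open>lam\<close> at \<open>(q, q1)\<close> is its
  value at \<open>(y^p, \<rho>)\<close>. By the choice of \<open>lam\<close> that value cancels the
  only term of \<open>q1t\<close> without a visible factor \<open>b\<close>.\<close>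

lemma q2_expansion:
  obtains m1 m2 m3 where "y_mod_a m1" "y_mod_a m2"
    "C2 b * (X ^ p + m2 * X + m1 + C2 b * m3) = q1t - ev2 C2 lam q q1 * w"
proof -
  obtain S2 where S2: "y_mod_a S2" "q1 ^ p - ev1 C2 \<rho>p q
    = C2 (b ^ (p - 1)) * (C2 b * X ^ p + w * Yv * [:pderiv \<rho>:] ^ p - C2 (b ^ (p - 1)) * w\<^sup>2 * Yv\<^sup>2 * S2)"
    by (rule q1_power_minus)
  have q1t_eq: "q1t = C2 b * X ^ p + w * Yv * [:pderiv \<rho>:] ^ p - C2 (b ^ (p - 1)) * w\<^sup>2 * Yv\<^sup>2 * S2"
    unfolding q1t_def S2(2) by (rule divR_C2_mult[OF b_power_nz])
  have "first_order y_mod_a (C2 b) X (ev2 C2 lam q q1) (ev2 C2 lam (Yv ^ p) [:\<rho>:])"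
  proof (rule first_order_ev2[OF subring_y_mod_a y_mod_a_C2])
    show "first_order y_mod_a (C2 b) X q (Yv ^ p)"
    proof (rule first_orderI)
      show "q = Yv ^ p + C2 b * (- (C2 d * Z) + 0 * X + C2 b * 0)"
        by (simp add: q_eq z_eq C2_a)
    qed (intro y_mod_a_intros y_mod_a_Z)+
    show "first_order y_mod_a (C2 b) X q1 [:\<rho>:]"
    proof (rule first_orderI)
      show "q1 = [:\<rho>:] + C2 b * (0 + 1 * X + C2 b * 0)"
        by (simp add: q1_eq)
    qed (intro y_mod_a_intros)+
  qed (simp add: rhom_0[OF rhom_C2])
  then obtain m1 m2 m3 where m: "y_mod_a m1" "y_mod_a m2"
    "ev2 C2 lam q q1 = ev2 C2 lam (Yv ^ p) [:\<rho>:] + C2 b * (m1 + m2 * X + C2 b * m3)"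
    unfolding first_order_def by blast
  have "ev2 C2 lam (Yv ^ p) [:\<rho>:] = [:ev2 (\<lambda>c. [:c:]) lam (monom 1 p) \<rho>:]"
    by (subst rhom_ev2_comp[OF rhom_const]) (simp add: Yv_power C2_def[abs_def])
  also have "\<dots> = [:pderiv \<rho>:] ^ p * Yv"
    by (simp only: lambda_eq rhom_mult[OF rhom_const] rhom_power[OF rhom_const] Yv_def)
  finally have lam: "ev2 C2 lam q q1 = [:pderiv \<rho>:] ^ p * Yv + C2 b * (m1 + m2 * X + C2 b * m3)"
    using m(3) by simp
  \<comment> \<open>Since p is at least 2, the second-order Taylor term also carries a factor
    \<open>b\<close> and can be absorbed into \<open>m1\<close>.\<close>
  have "p - 1 = Suc (p - 2)" using p_ge_2 by simp
  then have bp: "C2 (b ^ (p - 1)) = C2 b * C2 b ^ (p - 2)"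
    by (simp add: C2_mult C2_power)
  show thesis
  proof (rule that)
    show "C2 b * (X ^ p + (- (m2 * w)) * X + (- (C2 b ^ (p - 2) * w\<^sup>2 * Yv\<^sup>2 * S2) - m1 * w) + C2 b * (- (m3 * w)))
      = q1t - ev2 C2 lam q q1 * w"
      unfolding q1t_eq lam bp by (simp add: algebra_simps)
  qed (intro y_mod_a_intros y_mod_a_w S2(1) m(1,2))+
qed

lemma b_q2: "C2 b * q2 = q1t - ev2 C2 lam q q1 * w"
proof (rule q2_expansion)
  fix m1 m2 m3
  assume *: "C2 b * (X ^ p + m2 * X + m1 + C2 b * m3) = q1t - ev2 C2 lam q q1 * w"
  show ?thesis unfolding q2_def w_def[symmetric] *[symmetric] divR_C2_mult[OF b_nz] ..
qed

text \<open>Modulo \<open>b\<close> the coefficients become polynomials in y and \<open>X\<close>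
  becomes x + v, so \<open>q2\<close> becomes the p-th power of x + v plus terms at most linear in
  x.\<close>

lemma q2_monic_mod_b:
  obtains Q where "C2 b dvd q2 - Q" "degree Q = p" "lead_coeff Q = 1"
proof -
  obtain m1 m2 m3 where m: "y_mod_a m1" "y_mod_a m2"
    "C2 b * (X ^ p + m2 * X + m1 + C2 b * m3) = q1t - ev2 C2 lam q q1 * w"
    by (rule q2_expansion)
  have q2: "q2 = X ^ p + m2 * X + m1 + C2 b * m3"
  proof -
    have "C2 b * q2 = C2 b * (X ^ p + m2 * X + m1 + C2 b * m3)" by (simp only: m(3) b_q2)
    then show ?thesis using b_nz by (simp only: mult_cancel_left C2_eq_0_iff) simp
  qed
  have ab: "C2 b dvd C2 a" by (simp add: C2_a)
  have mod: "\<exists>v. C2 b dvd m - [:v:]" if "y_mod_a m" for m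
    using that ab by (auto simp: y_mod_a_def intro: dvd_trans)
  obtain v1 v2 v where v: "C2 b dvd m1 - [:v1:]" "C2 b dvd m2 - [:v2:]" "C2 b dvd Z * S - [:v:]"
    using mod[OF m(1)] mod[OF m(2)] mod[OF y_mod_a_intros(5)[OF y_mod_a_Z S(1)]] by blast
  define Q where "Q = [:v, 1:] ^ p + [:v2:] * [:v, 1:] + [:v1:]"
  have Xv: "[:v, 1:] = Xv + [:v:]" by (simp add: Xv_def)
  have X: "C2 b dvd X - [:v, 1:]" using v(3) unfolding X_def Xv by simp
  have "q2 - Q = (X ^ p - [:v, 1:] ^ p) + ((m2 - [:v2:]) * X + [:v2:] * (X - [:v, 1:])) + (m1 - [:v1:]) + C2 b * m3"
    by (simp add: q2 Q_def algebra_simps)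
  also have "C2 b dvd \<dots>"
    by (intro dvd_add power_cong_mod dvd_mult2[OF v(2)] dvd_mult[OF X] v(1) X dvd_triv_left)
  finally have *: "C2 b dvd q2 - Q" .
  have deg: "degree ([:v, 1:] ^ p) = p" by (simp add: degree_power_eq)
  have lc: "coeff ([:v, 1:] ^ p) p = 1"
    using lead_coeff_power[of "[:v, 1:]" p] by (simp add: deg)
  have small: "degree ([:v2:] * [:v, 1:] + [:v1:]) < p"
  proof -
    have "degree ([:v2:] * [:v, 1:] + [:v1:]) \<le> 1"
      by (simp add: degree_le coeff_pCons split: nat.splits)
    then show ?thesis using p_ge_2 by linarith
  qed
  have Q: "Q = [:v, 1:] ^ p + ([:v2:] * [:v, 1:] + [:v1:])" by (simp add: Q_def)
  have "degree Q = p" unfolding Q using small deg by (simp add: degree_add_eq_left)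
  moreover have "coeff Q p = 1" unfolding Q using small lc by (simp add: coeff_eq_0 del: mult_pCons_left)
  ultimately show thesis using that * by simp
qed

section \<open>Relations modulo a prime divisor of \<open>a\<close>\<close>

lemma p_minus_1: "p - 1 = Suc (p - 2)"
  using p_ge_2 by simp

text \<open>The substitution \<open>x \<mapsto> y - \<theta>(a x) / a\<close>, \<open>y \<mapsto> a x\<close> turns \<open>f\<close> into \<open>a y\<close> and \<open>q\<close> into a polynomial of
  degree \<open>p\<close> in \<open>x\<close>.\<close>

lemma q_f_independent:
  assumes "ev2 C2 g f q = 0"
  shows "g = 0"
proof -
  \<comment> \<open>As \<theta> has no constant term, \<open>Xv * T\<close> is \<theta>(ax) / a,
    obtained without dividing.\<close>
  obtain T where T: "ev1 C2 \<theta> (0 + C2 a * Xv) = ev1 C2 \<theta> 0 + C2 a * Xv * T"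
    by (rule ev1_taylor1[of C2 "\<lambda>_. True" 0 "C2 a * Xv" \<theta>])
      (auto simp: rhom_0[OF rhom_C2] subring_pred_def)
  have "ev1 C2 \<theta> 0 = 0"
    using theta_0 by (cases \<theta>) (simp_all add: ev1_pCons rhom_0[OF rhom_C2])
  with T have T: "ev1 C2 \<theta> (C2 a * Xv) = C2 a * (Xv * T)" by (simp only: add_0 mult.assoc)
  define \<psi> where "\<psi> u = ev2 C2 u (Yv - Xv * T) (C2 a * Xv)" for u
  have hom: "rhom \<psi>" unfolding \<psi>_def by (rule rhom_ev2[OF rhom_C2])
  note \<psi> = rhom_simps[OF hom]
  have C: "\<psi> (C2 c) = C2 c" for c by (simp add: \<psi>_def ev2_C2[OF rhom_C2])
  have X: "\<psi> Xv = Yv - Xv * T" and Y: "\<psi> Yv = C2 a * Xv"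
    by (simp_all add: \<psi>_def ev2_Xv[OF rhom_C2] ev2_Yv[OF rhom_C2])
  have f: "\<psi> f = C2 a * Yv"
  proof -
    have "\<psi> f = C2 a * (Yv - Xv * T) + ev1 C2 \<theta> (C2 a * Xv)"
      by (simp add: f_def \<psi> C X Y rhom_ev1_comp[OF hom])
    then show ?thesis unfolding T by (simp add: algebra_simps)
  qed
  define t where "t = [:0, a:]"
  have t: "C2 a * Yv = [:t:]" by (simp add: t_def C2_def Yv_def)
  define h where "h c = ev1 (\<lambda>c. [:c:]) c t" for c
  have h: "ev1 C2 c (C2 a * Yv) = [:h c:]" for c
    unfolding t h_def by (subst rhom_ev1_comp[OF rhom_const]) (simp add: C2_def[abs_def])
  have F: "\<psi> F = [:h G:]"
    by (simp add: F_eq rhom_ev1_comp[OF hom] C f h)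
  define u where "u = \<psi> q"
  have u: "u = monom ([:a:] ^ p) p - monom (([:a:] * h G) ^ (p - 1) * [:a:]) 1"
  proof -
    have "u = (C2 a * Xv) ^ p - ([:[:a:] * h G:]) ^ (p - 1) * (C2 a * Xv)"
    proof -
      have "C2 a * [:h G:] = [:[:a:] * h G:]" by (simp add: C2_def)
      then show ?thesis by (simp only: u_def q_def \<psi> C Y F)
    qed
    also have "C2 a * Xv = monom [:a:] 1"
      by (simp add: C2_def Xv_def monom_Suc monom_0)
    finally show ?thesis
      by (simp add: monom_power smult_monom flip: rhom_power[OF rhom_const])
  qed
  \<comment> \<open>This coefficient is \<open>a^p\<close>: the other monomial has degree 1 <
    p.\<close>
  have "coeff u p \<noteq> 0" using p_ge_2 a_nz by (simp add: u)
  then have deg: "degree u > 0" using ppos le_degree[of u p] by linarith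
  \<comment> \<open>The image \<open>u\<close> of \<open>q\<close> is made the outer argument: first
    \<open>u\<close> is transcendental in x over R[y], then \<open>t = a y\<close> is transcendental
    over R.\<close>
  define g' where "g' = ev2 C2 g Yv Xv"
  have "0 = \<psi> (ev2 C2 g f q)" using assms by (simp add: \<psi>)
  also have "\<dots> = ev2 C2 g (C2 a * Yv) u"
    by (simp add: rhom_ev2_comp[OF hom] C f u_def)
  also have "\<dots> = ev2 C2 g' u (C2 a * Yv)" by (simp add: g'_def ev2_swap[OF rhom_C2])
  also have "\<dots> = ev1 (\<lambda>c. [:h c:]) g' u" by (simp add: ev2_def h)
  finally have ev: "ev1 (\<lambda>c. [:h c:]) g' u = 0" by simp
  have "0 dvd h (coeff g' i)" for i
  proof (rule transcendental_mod)
    show "h 0 = 0" "[:h 0:] = 0" by (simp_all add: h_def ev1_0)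
    show "[:0:] dvd [:h c:] - [:h c:]" for c by simp
    show "[:0:] dvd u - u" by simp
    show "\<not> 0 dvd lead_coeff u" using deg by auto
    show "[:0:] dvd ev1 (\<lambda>c. [:h c:]) g' u" using ev by simp
  qed (simp_all add: prime_or_zero_iff deg)
  then have h0: "ev1 (\<lambda>c. [:c:]) (coeff g' i) t = 0" for i by (simp add: h_def)
  have "0 dvd coeff (coeff g' i) j" for i j
  proof (rule transcendental_mod[where h = "\<lambda>c. c" and emb = "\<lambda>c. [:c:]"])
    show "degree t > 0" "\<not> 0 dvd lead_coeff t" using a_nz by (simp_all add: t_def)
    show "[:0:] dvd ev1 (\<lambda>c. [:c:]) (coeff g' i) t" by (simp add: h0)
  qed (simp_all add: prime_or_zero_iff)
  then have "g' = 0" by (simp add: poly_eq_iff)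
  then have "ev2 C2 g' Yv Xv = 0" by (simp add: rhom_0[OF rhom_ev2[OF rhom_C2]])
  then show ?thesis by (simp add: g'_def ev2_swap_swap)
qed

lemma q_q1_independent:
  assumes "ev2 C2 g q1 q = 0"
  shows "g = 0"
proof -
  \<comment> \<open>At \<open>(q1, q)\<close> the polynomial \<open>[:\<theta>s, [:d:]:]\<close>
    takes the value \<open>f\<close>.\<close>
  obtain N g' where g': "pcompose g' [:\<theta>s, [:d:]:] = smult ([:d:] ^ N) g"
    by (rule linear_substitution_denominators)
  have hom: "rhom (\<lambda>c. ev1 C2 c q)" by (rule rhom_ev1[OF rhom_C2])
  have "ev2 C2 g' f q = ev1 (\<lambda>c. ev1 C2 c q) g' (ev1 (\<lambda>c. ev1 C2 c q) [:\<theta>s, [:d:]:] q1)"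
    using d_q1 by (simp add: ev2_def ev1_pCons ev1_0 rhom_0[OF rhom_C2] mult.commute)
  also have "\<dots> = ev2 C2 (smult ([:d:] ^ N) g) q1 q"
    by (simp add: ev2_def g' flip: ev1_pcompose[OF hom])
  also have "\<dots> = 0"
    using assms by (simp add: ev2_def ev1_smult[OF hom])
  finally have "g' = 0" by (rule q_f_independent)
  then show ?thesis using g' d_nz by simp
qed

lemma C2_dvd_C2: "x dvd y \<Longrightarrow> C2 x dvd (C2 y :: 'a poly poly)"
  by (rule rhom_dvd[OF rhom_C2])

lemma q_mod:
  assumes "\<pi> dvd a" shows "C2 \<pi> dvd q - [:monom 1 p:]"
proof -
  have "C2 \<pi> dvd - (C2 a * Z)" using C2_dvd_C2[OF assms] by simp
  then show ?thesis by (simp add: q_eq z_eq Yv_power)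
qed

text \<open>For nonzero \<pi>, modulo \<pi> the element \<open>q\<close> is \<open>y^p\<close>, and
  \<open>q1\<close> is linear in x with leading coefficient \<open>b\<close>, which \<pi> does not
  divide.\<close>

lemma q_q1_independent_mod:
  assumes \<pi>: "prime_or_zero \<pi>" "\<pi> = 0 \<or> \<pi> dvd a" "\<not> \<pi> dvd b"
    and dv: "C2 \<pi> dvd ev2 C2 g q1 q"
  shows "C2 \<pi> dvd g"
proof (cases "\<pi> = 0")
  case True
  then show ?thesis using dv q_q1_independent by (simp add: rhom_0[OF rhom_C2])
next
  case False
  then have \<pi>a: "\<pi> dvd a" using \<pi>(2) by simp
  have "y_mod_a (Z * S)" by (intro y_mod_a_intros y_mod_a_Z S)
  then obtain v where v: "C2 a dvd Z * S - [:v:]" by (auto simp: y_mod_a_def)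
  define h where "h c = ev1 (\<lambda>c. [:c:]) c (monom 1 p)" for c :: "'a poly"
  define u where "u = [:smult b v + \<rho>, [:b:]:]"
  have *: "[:\<pi>:] dvd h (coeff g i)" for i
  proof (rule transcendental_mod)
    show "prime_or_zero [:\<pi>:]" by (rule prime_or_zero_const[OF \<pi>(1)])
    show "[:[:\<pi>:]:] dvd ev1 C2 c q - [:h c:]" for c
    proof -
      have "C2 \<pi> dvd ev1 C2 c q - ev1 C2 c [:monom 1 p:]"
        by (rule ev1_cong_mod) (simp_all add: rhom_0[OF rhom_C2] q_mod[OF \<pi>a])
      then show ?thesis
        using const_ev1_power_p[of c] by (simp add: h_def Yv_power C2_def)
    qed
    have "q1 - u = C2 b * (Z * S - [:v:])"
      by (simp add: q1_eq X_def u_def C2_def Xv_def algebra_simps)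
    also have "C2 \<pi> dvd \<dots>" using C2_dvd_C2[OF \<pi>a] v by (blast intro: dvd_mult dvd_trans)
    finally show "[:[:\<pi>:]:] dvd q1 - u" by (simp add: C2_def)
    show "degree u > 0" using b_nz by (simp add: u_def)
    show "\<not> [:\<pi>:] dvd lead_coeff u" using b_nz \<pi>(3) by (simp add: u_def)
    show "[:[:\<pi>:]:] dvd ev1 (\<lambda>c. ev1 C2 c q) g q1" using dv by (simp add: C2_def ev2_def)
  qed (simp_all add: h_def ev1_0 rhom_0[OF rhom_C2])
  have "\<pi> dvd coeff (coeff g i) j" for i j
    using *[of i] ppos
    by (auto simp: const_poly_dvd_iff h_def coeff_ev1_monom dest!: spec[of _ "p * j"])
  then show ?thesis by (simp add: C2_dvd_iff)
qed

text \<open>In the following the variables of \<open>R[y\<^sub>0, y\<^sub>1, y\<^sub>2]\<close> are nested in reverse order, \<open>y\<^sub>2\<close> being the outermost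
  one; \<open>\<Lambda>'\<close> and \<open>\<sigma>'\<close> are \<open>\<Lambda>\<close> and \<open>\<sigma>\<close> in this order, and \<open>M0\<close> is \<open>\<rho>\<^sup>p(y\<^sub>0) - y\<^sub>1\<^sup>p\<close>.\<close>

definition "M0 = [:\<rho>p:] - Xv ^ p"
definition "\<Lambda>1 = [:C2 (b ^ (p - 2)) * ev2 C2 lam Yv Xv * ev2 C2 \<nu> Yv Xv, C2 (b ^ (p - 1)):]"
definition "\<Lambda>' = [:M0:] + C3 b * \<Lambda>1"

lemma C3_eq: "C3 c = [:C2 c:]"
  by (simp add: C3_def C2_def)

lemma \<Lambda>'_eq: "\<Lambda>' = [:M0 + C2 (b ^ (p - 1)) * ev2 C2 lam Yv Xv * ev2 C2 \<nu> Yv Xv, C2 (b ^ p):]"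
proof -
  have "C2 (b ^ (p - 2)) * C2 b = C2 (b ^ (p - 1))" unfolding p_minus_1 by (simp add: C2_mult)
  moreover have "C2 (b ^ (p - 1)) * C2 b = C2 (b ^ p)"
    using ppos by (metis C2_mult power_minus_mult)
  ultimately show ?thesis
    by (simp add: \<Lambda>'_def \<Lambda>1_def C3_eq mult.assoc[symmetric])
qed

definition "\<sigma>' g = ev3 C2 g q2 q1 q"

lemma rhom_\<sigma>': "rhom \<sigma>'"
  unfolding \<sigma>'_def by (rule rhom_ev3[OF rhom_C2])

lemmas \<sigma>'_simps = rhom_simps[OF rhom_\<sigma>']

lemma \<sigma>'_C3: "\<sigma>' (C3 c) = C2 c"
  by (simp add: \<sigma>'_def ev3_C3[OF rhom_C2])

lemma \<sigma>'_const: "\<sigma>' [:c:] = ev2 C2 c q1 q"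
  by (simp add: \<sigma>'_def ev3_const[OF rhom_C2])

text \<open>This is the definition of \<open>q2\<close> with both divisions by powers of
  \<open>b\<close> cleared.\<close>

lemma \<sigma>'_\<Lambda>': "\<sigma>' \<Lambda>' = 0"
proof -
  note hom = rhom_ev2[OF rhom_C2, of q1 q]
  have "\<sigma>' \<Lambda>' = ev2 C2 (M0 + C2 (b ^ (p - 1)) * ev2 C2 lam Yv Xv * ev2 C2 \<nu> Yv Xv) q1 q
     + q2 * ev2 C2 (C2 (b ^ p)) q1 q"
    by (simp add: \<sigma>'_def \<Lambda>'_eq ev3_def ev1_pCons ev1_0 rhom_0[OF hom])
  also have "\<dots> = ev1 C2 \<rho>p q - q1 ^ p + C2 (b ^ (p - 1)) * ev2 C2 lam q q1 * w + q2 * C2 (b ^ p)"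
    by (simp add: M0_def rhom_simps[OF hom] ev2_C2[OF rhom_C2] ev2_Xv[OF rhom_C2] ev2_const[OF rhom_C2]
        ev2_swap[OF rhom_C2] nu_eq)
  also have "q2 * C2 (b ^ p) = C2 (b ^ (p - 1)) * (C2 b * q2)"
    using ppos by (metis C2_mult power_minus_mult mult.commute mult.assoc)
  also have "\<dots> = C2 (b ^ (p - 1)) * q1t - C2 (b ^ (p - 1)) * (ev2 C2 lam q q1 * w)"
    by (simp only: b_q2 right_diff_distrib)
  finally show ?thesis by (simp only: q1t) (simp add: mult.assoc)
qed

lemma lead_coeff_M0: "lead_coeff (- M0) = 1" and degree_M0: "degree (- M0) = p"
proof -
  have 1: "- M0 = monom 1 p + [:- \<rho>p:]"
  proof -
    have "[:- \<rho>p:] = - [:\<rho>p:]" by simp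
    then show ?thesis by (simp only: M0_def Xv_def monom_altdef) simp
  qed
  have "degree (monom 1 p + [:- \<rho>p:]) = p"
    using ppos by (subst degree_add_eq_left) (simp_all add: degree_monom_eq)
  then show deg: "degree (- M0) = p" unfolding 1 .
  show "lead_coeff (- M0) = 1" unfolding deg using ppos by (simp add: 1 coeff_pCons split: nat.splits)
qed

section \<open>Membership in the ideal generated by \<Lambda> and \<pi>\<close>

definition "in_ideal \<pi> g \<longleftrightarrow> (\<exists>h k. g = \<Lambda>' * h + C3 \<pi> * k)"

lemma in_ideal_cancel:
  assumes \<pi>: "prime_or_zero \<pi>" "\<not> \<pi> dvd b" and g: "in_ideal \<pi> (C3 b * g)"
  shows "in_ideal \<pi> g"
proof -
  obtain h k where hk: "C3 b * g = \<Lambda>' * h + C3 \<pi> * k" using g by (auto simp: in_ideal_def)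
  have eq: "[:- M0:] * h = C3 b * (\<Lambda>1 * h - g) + C3 \<pi> * k"
    using hk by (simp add: \<Lambda>'_def algebra_simps flip: minus_pCons)
  \<comment> \<open>Each coefficient of \<open>h\<close> in y2 is a polynomial in y1 over R[y0];
    there \<open>- M0\<close> is monic and cancels modulo \<open>b\<close> and \<pi>.\<close>
  have "\<exists>u v. coeff h n = C2 b * u + C2 \<pi> * v" for n
  proof -
    have "coeff ([:- M0:] * h) n = coeff (C3 b * (\<Lambda>1 * h - g) + C3 \<pi> * k) n" by (simp only: eq)
    then have "- M0 * coeff h n = smult [:b:] (coeff (\<Lambda>1 * h - g) n) + smult [:\<pi>:] (coeff k n)"
      by (simp add: C3_eq C2_def)
    then show ?thesis
      by (rule monic_cancel_combination[OF lead_coeff_M0]) (auto simp: C2_def)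
  qed
  then obtain h1 h2 where h: "h = smult (C2 b) h1 + smult (C2 \<pi>) h2" by (rule smult_combination)
  then have h: "h = C3 b * h1 + C3 \<pi> * h2" by (simp add: C3_eq)
  \<comment> \<open>Inserting \<open>h\<close> moves its \<open>b\<close> part to the left, after
    which \<pi> must divide the other factor.\<close>
  have "C3 b * (g - \<Lambda>' * h1) = C3 \<pi> * (k + \<Lambda>' * h2)"
    using hk unfolding h by (simp add: algebra_simps)
  then have "C3 \<pi> dvd C3 b * (g - \<Lambda>' * h1)" by simp
  moreover have "\<not> C3 \<pi> dvd C3 b" using \<pi>(2) by (simp add: C3_def)
  ultimately have "C3 \<pi> dvd g - \<Lambda>' * h1"
    using prime_or_zero_C3[OF \<pi>(1)] by (auto simp: prime_or_zero_def)
  then obtain k' where "g - \<Lambda>' * h1 = C3 \<pi> * k'" by (rule dvdE)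
  then have "g = \<Lambda>' * h1 + C3 \<pi> * k'" by (simp add: algebra_simps)
  then show ?thesis by (auto simp: in_ideal_def)
qed

lemma in_ideal_cancel_power:
  assumes \<pi>: "prime_or_zero \<pi>" "\<not> \<pi> dvd b"
  shows "in_ideal \<pi> (C3 b ^ n * g) \<Longrightarrow> in_ideal \<pi> g"
  by (induction n) (auto simp: mult.assoc intro: in_ideal_cancel[OF \<pi>])

lemma in_ideal_not_dvd:
  assumes \<pi>: "prime_or_zero \<pi>" "\<pi> = 0 \<or> \<pi> dvd a" "\<not> \<pi> dvd b" and dv: "C2 \<pi> dvd \<sigma>' g"
  shows "in_ideal \<pi> g"
proof -
  obtain N h g0 where "smult (C2 (b ^ p) ^ N) g = \<Lambda>' * h + [:g0:]"
    unfolding \<Lambda>'_eq by (rule linear_pseudo_division)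
  moreover have "smult (C2 (b ^ p) ^ N) g = C3 b ^ (p * N) * g"
    by (simp add: C3_eq C2_power power_mult flip: rhom_power[OF rhom_const])
  ultimately have eq: "C3 b ^ (p * N) * g = \<Lambda>' * h + [:g0:]" by simp
  have "ev2 C2 g0 q1 q = \<sigma>' (C3 b ^ (p * N) * g)"
    unfolding eq by (simp add: \<sigma>'_simps \<sigma>'_\<Lambda>' \<sigma>'_const)
  also have "C2 \<pi> dvd \<dots>" using dv by (simp add: \<sigma>'_simps)
  finally have "C2 \<pi> dvd g0" by (rule q_q1_independent_mod[OF \<pi>])
  then obtain k where k: "g0 = C2 \<pi> * k" by (rule dvdE)
  have "C3 b ^ (p * N) * g = \<Lambda>' * h + C3 \<pi> * [:k:]"
    unfolding eq k by (simp add: C3_eq mult.commute)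
  then have "in_ideal \<pi> (C3 b ^ (p * N) * g)" unfolding in_ideal_def by blast
  then show ?thesis by (rule in_ideal_cancel_power[OF \<pi>(1,3)])
qed

text \<open>The derivative of \<theta> is \<open>d\<close> times that of \<open>\<rho>\<close>, so
  otherwise \<open>\<pi> * d\<close> would be a common divisor of \<open>a\<close> and that
  derivative, contradicting the choice of \<open>d\<close>.\<close>

lemma not_dvd_pderiv_\<rho>:
  assumes "prime_or_zero \<pi>" "\<pi> dvd b"
  shows "\<not> [:\<pi>:] dvd pderiv \<rho>"
proof
  assume *: "[:\<pi>:] dvd pderiv \<rho>"
  have "pderiv (ev1 (\<lambda>c. [:c:]) \<theta>s (monom 1 p)) = 0"
    using ppos charp by (intro poly_eqI) (auto simp: coeff_pderiv coeff_ev1_monom of_nat_eq_0_iff_char_dvd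
      simp del: of_nat_Suc)
  then have "pderiv \<theta> = smult d (pderiv \<rho>)"
    by (subst \<theta>_decomp) (simp add: pderiv_add pderiv_smult)
  then have "[:\<pi> * d:] dvd pderiv \<theta>" using * by (auto simp: const_poly_dvd_iff mult.commute intro: mult_dvd_mono)
  moreover have "[:\<pi> * d:] dvd [:a:]" using assms(2) by (simp add: a_eq mult_dvd_mono)
  ultimately have "\<pi> * d dvd 1 * d" using d_gcd by (metis const_poly_dvd_const_poly_iff mult_1)
  then have "\<pi> dvd 1" using d_nz by (simp only: dvd_mult_cancel_right) simp
  then show False using assms(1) by (simp add: prime_or_zero_def)
qed

text \<open>Division by the monic \<open>- M0\<close> leaves degree less than p in y1. The remainder
  gives a relation among the first p powers of \<open>\<rho>\<close> with coefficients in R[y^p],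
  and all of these are divisible by \<pi>.\<close>

lemma kernel_y_mod:
  assumes \<pi>: "prime_or_zero \<pi>" "\<pi> dvd b"
    and dv: "[:\<pi>:] dvd ev2 (\<lambda>c. [:c:]) c \<rho> (monom 1 p)"
  shows "\<exists>s t. c = M0 * s + C2 \<pi> * t"
proof -
  note hom = rhom_ev2[OF rhom_const, of \<rho> "monom 1 p"]
  obtain h r where hr: "c = - M0 * h + r" "r = 0 \<or> degree r < p"
    using monic_division[OF lead_coeff_M0, of c] unfolding degree_M0 by blast
  have M0: "ev2 (\<lambda>c. [:c:]) M0 \<rho> (monom 1 p) = 0"
    by (simp add: M0_def rhom_simps[OF hom] ev2_const[OF rhom_const] ev2_Xv[OF rhom_const] \<rho>_power)
  define H where "H = map_poly (\<lambda>c. ev1 (\<lambda>c. [:c:]) c (monom 1 p)) r"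
  have coeff_H: "coeff H i = ev1 (\<lambda>c. [:c:]) (coeff r i) (monom 1 p)" for i
    by (simp add: H_def coeff_map_poly ev1_0)
  have "ev2 (\<lambda>c. [:c:]) c \<rho> (monom 1 p) = poly H \<rho>"
    unfolding hr(1) rhom_simps[OF hom] M0 H_def by (simp add: ev2_def ev1_map_poly ev1_0)
  then have "[:\<pi>:] dvd poly H \<rho>" using dv by simp
  moreover have "pderiv (coeff H i) = 0" for i
    unfolding coeff_H using ppos charp
    by (intro poly_eqI) (auto simp: coeff_pderiv coeff_ev1_monom of_nat_eq_0_iff_char_dvd simp del: of_nat_Suc)
  moreover have "degree H < p"
  proof (rule degree_lessI)
    show "\<forall>k\<ge>p. coeff H k = 0"
      using hr(2) by (auto simp: coeff_H coeff_eq_0 ev1_0)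
  qed (use ppos in simp)
  ultimately have "[:\<pi>:] dvd coeff H i" for i
    by (intro powers_independent_mod[OF charp prime_p \<pi>(1) not_dvd_pderiv_\<rho>[OF \<pi>]])
  then have "\<pi> dvd coeff (coeff r i) j" for i j
    using ppos by (auto simp: const_poly_dvd_iff coeff_H coeff_ev1_monom dest!: spec[of _ "p * j"] meta_spec[of _ i])
  then have "C2 \<pi> dvd r" by (simp add: C2_dvd_iff)
  then obtain t where "r = C2 \<pi> * t" by (rule dvdE)
  then have "c = M0 * (- h) + C2 \<pi> * t" by (simp add: hr(1))
  then show ?thesis by blast
qed

text \<open>Since \<open>q2\<close> is monic in x modulo \<pi>, each coefficient of \<open>g\<close>
  in y2 is itself a relation between \<open>y^p\<close> and \<open>\<rho>\<close>. As \<pi> divides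
  \<open>b\<close>, \<open>M0\<close> and \<open>\<Lambda>'\<close> agree modulo \<pi>.\<close>

lemma in_ideal_dvd:
  assumes \<pi>: "prime_or_zero \<pi>" "\<pi> dvd b" and dv: "C2 \<pi> dvd \<sigma>' g"
  shows "in_ideal \<pi> g"
proof -
  have \<pi>a: "\<pi> dvd a" using \<pi>(2) by (simp add: a_eq)
  define e where "e c = ev2 (\<lambda>c. [:c:]) c \<rho> (monom 1 p)" for c :: "'a poly poly"
  obtain Q where Q: "C2 b dvd q2 - Q" "degree Q = p" "lead_coeff Q = 1" by (rule q2_monic_mod_b)
  have "[:\<pi>:] dvd e (coeff g i)" for i
  proof (rule transcendental_mod)
    show "prime_or_zero [:\<pi>:]" by (rule prime_or_zero_const[OF \<pi>(1)])
    show "[:[:\<pi>:]:] dvd ev2 C2 c q1 q - [:e c:]" for c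
    proof -
      have "C2 \<pi> dvd q1 - [:\<rho>:]" using C2_dvd_C2[OF \<pi>(2)] by (simp add: q1_eq)
      then have "C2 \<pi> dvd ev2 C2 c q1 q - ev2 C2 c [:\<rho>:] [:monom 1 p:]"
        by (intro ev2_cong_mod) (simp_all add: rhom_0[OF rhom_C2] q_mod[OF \<pi>a])
      moreover have "ev2 C2 c [:\<rho>:] [:monom 1 p:] = [:e c:]"
        unfolding e_def by (subst rhom_ev2_comp[OF rhom_const]) (simp add: C2_def[abs_def])
      ultimately show ?thesis by (simp add: C2_def)
    qed
    have "C2 \<pi> dvd q2 - Q" using C2_dvd_C2[OF \<pi>(2)] Q(1) by (rule dvd_trans)
    then show "[:[:\<pi>:]:] dvd q2 - Q" by (simp add: C2_def)
    show "degree Q > 0" using Q ppos by simp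
    show "\<not> [:\<pi>:] dvd lead_coeff Q"
      using prime_or_zero_const[OF \<pi>(1)] by (simp add: Q(3) prime_or_zero_def)
    show "[:[:\<pi>:]:] dvd ev1 (\<lambda>c. ev2 C2 c q1 q) g q2" using dv by (simp add: C2_def ev3_def \<sigma>'_def)
  qed (simp_all add: e_def rhom_0[OF rhom_ev2[OF rhom_C2]] rhom_0[OF rhom_ev2[OF rhom_const]])
  then have "\<exists>s t. coeff g i = M0 * s + C2 \<pi> * t" for i
    unfolding e_def by (intro kernel_y_mod[OF \<pi>])
  then obtain h k where hk: "g = smult M0 h + smult (C2 \<pi>) k" by (rule smult_combination)
  obtain c where "b = \<pi> * c" using \<pi>(2) by (rule dvdE)
  then have c: "C3 b = C3 \<pi> * C3 c" by (simp add: rhom_mult[OF rhom_C3])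
  have "g = [:M0:] * h + C3 \<pi> * k" by (simp add: hk C3_eq)
  also have "\<dots> = \<Lambda>' * h + C3 \<pi> * (k - C3 c * \<Lambda>1 * h)"
    by (simp add: \<Lambda>'_def c algebra_simps)
  finally show ?thesis by (auto simp: in_ideal_def)
qed

lemma in_idealI:
  assumes "prime_or_zero \<pi>" "\<pi> = 0 \<or> \<pi> dvd a" "C2 \<pi> dvd \<sigma>' g"
  shows "in_ideal \<pi> g"
  using assms in_ideal_dvd in_ideal_not_dvd by blast

lemma kernel_\<sigma>': "\<sigma>' g = 0 \<longleftrightarrow> \<Lambda>' dvd g"
proof
  assume "\<sigma>' g = 0"
  then have "in_ideal 0 g" by (intro in_idealI) (simp_all add: prime_or_zero_iff)
  then show "\<Lambda>' dvd g" by (auto simp: in_ideal_def rhom_0[OF rhom_C3])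
qed (auto simp: \<sigma>'_simps \<sigma>'_\<Lambda>')

text \<open>If \<open>\<sigma>' g\<close> equals \<open>r * c * u\<close> for a prime r, then g is
  \<open>\<Lambda>' * h\<close> plus r times some k. Applying \<open>\<sigma>'\<close> and
  cancelling r gives \<open>c * u = \<sigma>' k\<close>.\<close>

lemma range_\<sigma>'_saturated:
  assumes "c dvd a ^ n" "C2 c * u \<in> range \<sigma>'"
  shows "u \<in> range \<sigma>'"
  using assms
proof (induction c arbitrary: u rule: prime_divisors_induct)
  case zero
  then show ?case using a_nz by simp
next
  case (unit c)
  then obtain c' where c': "1 = c * c'" by (auto elim: dvdE)
  obtain g where g: "C2 c * u = \<sigma>' g" using unit.prems by auto
  have "u = C2 (c * c') * u" by (simp add: c'[symmetric] rhom_1[OF rhom_C2])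
  also have "\<dots> = C2 c' * (C2 c * u)" by (simp only: C2_mult ac_simps)
  also have "\<dots> = \<sigma>' (C3 c' * g)" by (simp add: g \<sigma>'_simps \<sigma>'_C3)
  finally show ?case by (rule range_eqI)
next
  case (factor r c)
  have r: "prime_or_zero r" using factor(1) by (simp add: prime_or_zero_iff)
  have "r dvd a" using factor(1) factor.prems(1) by (meson dvd_mult_left prime_dvd_power)
  obtain g where g: "C2 (r * c) * u = \<sigma>' g" using factor.prems by auto
  then have g: "\<sigma>' g = C2 r * (C2 c * u)" by (simp add: C2_mult mult.assoc)
  then have "in_ideal r g" using r \<open>r dvd a\<close> by (intro in_idealI) auto
  then obtain h k where "g = \<Lambda>' * h + C3 r * k" by (auto simp: in_ideal_def)
  then have "C2 r * \<sigma>' k = C2 r * (C2 c * u)" using g by (simp add: \<sigma>'_simps \<sigma>'_\<Lambda>' \<sigma>'_C3)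
  moreover have "C2 r \<noteq> 0" using factor(1) by (auto simp: C2_eq_0_iff)
  ultimately have "C2 c * u = \<sigma>' k" by simp
  then show ?case using factor.IH factor.prems(1) by (metis dvd_mult_right range_eqI)
qed

section \<open>The image\<close>

lemma rhom_\<phi>: "rhom \<phi>"
  unfolding \<phi>_def by (rule rhom_ev2[OF rhom_C2])

lemmas \<phi>_simps = rhom_simps[OF rhom_\<phi>]

lemma \<phi>_C2: "\<phi> (C2 c) = C2 c"
  by (simp add: \<phi>_def ev2_C2[OF rhom_C2])

lemma \<phi>_Xv: "\<phi> Xv = \<phi>x"
  by (simp add: \<phi>_def ev2_Xv[OF rhom_C2])

lemma \<phi>_Yv: "\<phi> Yv = Yv + C2 a * F"
  by (simp add: \<phi>_def ev2_Yv[OF rhom_C2] \<phi>y_def)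

lemma \<phi>_ev1: "\<phi> (ev1 C2 g u) = ev1 C2 g (\<phi> u)"
  by (simp add: rhom_ev1_comp[OF rhom_\<phi>] \<phi>_C2)

lemma \<phi>_ev2: "\<phi> (ev2 C2 g u v) = ev2 C2 g (\<phi> u) (\<phi> v)"
  by (simp add: rhom_ev2_comp[OF rhom_\<phi>] \<phi>_C2)

text \<open>Taylor expansion shows that the difference is a multiple of \<open>a\<close>, so the
  division in \<open>\<phi>x\<close> is exact.\<close>

lemma a_\<phi>x: "C2 a * \<phi>x = C2 a * Xv + (ev1 C2 \<theta> Yv - ev1 C2 \<theta> (Yv + C2 a * F))"
proof -
  obtain T where "ev1 C2 \<theta> (Yv + C2 a * F) = ev1 C2 \<theta> Yv + C2 a * F * T"
    by (rule ev1_taylor1[of C2 "\<lambda>_. True" Yv "C2 a * F" \<theta>])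
      (auto simp: rhom_0[OF rhom_C2] subring_pred_def)
  then have *: "ev1 C2 \<theta> Yv - ev1 C2 \<theta> (Yv + C2 a * F) = C2 a * (- (F * T))"
    by (simp add: mult.assoc)
  show ?thesis unfolding \<phi>x_def * divR_C2_mult[OF a_nz] by (rule distrib_left)
qed

lemma \<phi>_f: "\<phi> f = f"
  by (simp add: f_def \<phi>_simps \<phi>_C2 \<phi>_Xv \<phi>_ev1 \<phi>_Yv a_\<phi>x)

lemma \<phi>_F: "\<phi> F = F"
  using \<phi>_ev1[of G f] by (simp only: \<phi>_f F_eq[symmetric])

text \<open>By Frobenius \<open>Yv^p\<close> grows by \<open>(aF)^p\<close>, exactly the growth of
  the subtracted term.\<close>

lemma \<phi>_q: "\<phi> q = q"
proof -
  have "(Yv + C2 a * F) ^ p = Yv ^ p + (C2 a * F) ^ p"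
    by (rule freshmans_dream) (use prime_p char_poly in auto)
  also have "(C2 a * F) ^ p = (C2 a * F) ^ (p - 1) * (C2 a * F)"
    by (rule power_minus_mult[symmetric]) (rule ppos)
  finally show ?thesis
    by (simp add: q_def \<phi>_simps \<phi>_C2 \<phi>_F \<phi>_Yv algebra_simps)
qed

text \<open>Invariance is checked on the equation with cleared denominator; \<open>q1t\<close> and
  \<open>q2\<close> are handled the same way.\<close>

lemma \<phi>_q1: "\<phi> q1 = q1"
proof -
  have "C2 d * \<phi> q1 = \<phi> (C2 d * q1)" by (simp add: \<phi>_simps \<phi>_C2)
  also have "\<dots> = C2 d * q1" by (simp add: d_q1 \<phi>_simps \<phi>_f \<phi>_ev1 \<phi>_q)
  finally show ?thesis using d_nz by (simp add: C2_eq_0_iff)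
qed

lemma \<phi>_q1t: "\<phi> q1t = q1t"
proof -
  have "C2 (b ^ (p - 1)) * \<phi> q1t = \<phi> (C2 (b ^ (p - 1)) * q1t)" by (simp add: \<phi>_simps \<phi>_C2)
  also have "\<dots> = C2 (b ^ (p - 1)) * q1t" by (simp only: q1t \<phi>_simps \<phi>_q1 \<phi>_ev1 \<phi>_q)
  finally show ?thesis using b_nz by (simp add: C2_eq_0_iff)
qed

lemma \<phi>_q2: "\<phi> q2 = q2"
proof -
  have "C2 b * \<phi> q2 = \<phi> (C2 b * q2)" by (simp add: \<phi>_simps \<phi>_C2)
  also have "\<dots> = C2 b * q2" by (simp add: b_q2 \<phi>_simps \<phi>_q1t \<phi>_ev2 \<phi>_q \<phi>_q1 nu_eq)
  finally show ?thesis using b_nz by (simp add: C2_eq_0_iff)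
qed

lemma \<phi>_\<sigma>': "\<phi> (\<sigma>' g) = \<sigma>' g"
  by (simp add: \<sigma>'_def rhom_ev3_comp[OF rhom_\<phi>] \<phi>_C2 \<phi>_q \<phi>_q1 \<phi>_q2)

section \<open>The module spanned by powers of y over the image\<close>

lemma subring_range: "subring_pred (\<lambda>u. u \<in> range \<sigma>')"
  unfolding subring_pred_def
  by (auto simp: image_iff simp flip: \<sigma>'_simps intro: exI[of _ 0] exI[of _ 1])

lemmas range_intros = subring_pred_intros[OF subring_range]

lemma range_C2: "C2 c \<in> range \<sigma>'"
  using \<sigma>'_C3 by (metis rangeI)

lemma range_q: "q \<in> range \<sigma>'" and range_q1: "q1 \<in> range \<sigma>'"
  using ev3_Y2[OF rhom_C2, of q2 q1 q] ev3_Y1[OF rhom_C2, of q2 q1 q]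
  by (auto simp: \<sigma>'_def image_iff intro: sym)

lemma range_f: "f \<in> range \<sigma>'"
proof -
  have "f = C2 d * q1 + ev1 C2 \<theta>s q" by (simp add: d_q1)
  also have "\<dots> \<in> range \<sigma>'"
    by (intro range_intros subring_pred_ev1[OF subring_range] range_C2 range_q range_q1)
  finally show ?thesis .
qed

lemma range_F: "F \<in> range \<sigma>'"
proof -
  have "ev1 C2 G f \<in> range \<sigma>'"
    by (intro subring_pred_ev1[OF subring_range] range_C2 range_f)
  then show ?thesis by (simp only: F_eq[symmetric])
qed

definition "y_span u \<longleftrightarrow> (\<exists>H. (\<forall>i. coeff H i \<in> range \<sigma>') \<and> degree H < p \<and> u = poly H Yv)"

lemma y_spanI: "(\<And>i. coeff H i \<in> range \<sigma>') \<Longrightarrow> degree H < p \<Longrightarrow> u = poly H Yv \<Longrightarrow> y_span u"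
  by (auto simp: y_span_def)

lemma y_span_add: assumes "y_span u" "y_span v" shows "y_span (u + v)"
proof -
  obtain H K where HK: "\<And>i. coeff H i \<in> range \<sigma>'" "degree H < p" "u = poly H Yv"
    "\<And>i. coeff K i \<in> range \<sigma>'" "degree K < p" "v = poly K Yv"
    using assms by (auto simp: y_span_def)
  show ?thesis
  proof (rule y_spanI[of "H + K"])
    show "coeff (H + K) i \<in> range \<sigma>'" for i
      unfolding coeff_add by (intro range_intros HK)
  qed (use HK in \<open>simp_all add: degree_add_less\<close>)
qed

lemma y_span_range_mult: assumes "c \<in> range \<sigma>'" "y_span u" shows "y_span (c * u)"
proof -
  obtain H where H: "\<And>i. coeff H i \<in> range \<sigma>'" "degree H < p" "u = poly H Yv"
    using assms by (auto simp: y_span_def)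
  show ?thesis
  proof (rule y_spanI[of "smult c H"])
    show "coeff (smult c H) i \<in> range \<sigma>'" for i
      unfolding coeff_smult by (intro range_intros H assms)
  qed (use H degree_smult_le[of c H] in auto)
qed

lemma y_span_range: assumes "c \<in> range \<sigma>'" shows "y_span c"
proof (rule y_spanI[of "[:c:]"])
  show "coeff [:c:] i \<in> range \<sigma>'" for i
    using assms by (cases i) (simp_all add: range_intros(1))
qed (simp_all add: ppos)

lemma y_span_Yv_mult: assumes "y_span u" shows "y_span (Yv * u)"
proof -
  obtain H where H: "\<And>i. coeff H i \<in> range \<sigma>'" "degree H < p" "u = poly H Yv"
    using assms by (auto simp: y_span_def)
  define c where "c = coeff H (p - 1)"
  \<comment> \<open>A monic relation of degree p for y over the image; subtracting \<open>c\<close>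
    times it removes the overflow in degree p.\<close>
  define R where "R = monom 1 p - monom ((C2 a * F) ^ (p - 1)) 1 - monom q 0"
  have R: "poly R Yv = 0" by (simp add: R_def poly_monom q_def)
  show ?thesis
  proof (rule y_spanI[of "pCons 0 H - smult c R"])
    have H_range: "coeff (pCons 0 H) i \<in> range \<sigma>'" for i
      using H(1) by (cases i) (simp_all add: range_intros(1))
    have mon: "coeff (monom v n) i \<in> range \<sigma>'" if "v \<in> range \<sigma>'" for v n i
      using that by (cases "i = n") (simp_all add: range_intros(1))
    have R_range: "coeff R i \<in> range \<sigma>'" for i
      unfolding R_def coeff_diff
      by (intro range_intros(6) mon range_intros(2,7) range_intros(5)[OF range_C2 range_F] range_q)
    show "coeff (pCons 0 H - smult c R) i \<in> range \<sigma>'" for i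
      unfolding coeff_diff coeff_smult c_def by (intro range_intros(5,6) H(1) H_range R_range)
    show "degree (pCons 0 H - smult c R) < p"
    proof (rule degree_lessI)
      show "\<forall>k\<ge>p. coeff (pCons 0 H - smult c R) k = 0"
      proof (intro allI impI)
        fix k assume "k \<ge> p"
        then obtain j where j: "k = Suc j" using ppos by (cases k) auto
        show "coeff (pCons 0 H - smult c R) k = 0"
        proof (cases "k = p")
          case True
          then have "coeff (pCons 0 H) k = c" "coeff R k = 1"
            using j p_ge_2 by (auto simp: R_def c_def)
          then show ?thesis by simp
        next
          case False
          then have "degree H < j" using \<open>k \<ge> p\<close> j H(2) by simp
          then show ?thesis using False \<open>k \<ge> p\<close> j p_ge_2 by (simp add: R_def coeff_eq_0)
        qed
      qed
    qed (use ppos in simp)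
    show "Yv * u = poly (pCons 0 H - smult c R) Yv" by (simp add: R H(3))
  qed
qed

lemma y_span_const_mult: "y_span u \<Longrightarrow> y_span ([:c:] * u)"
proof (induction c)
  case 0
  show ?case using y_span_range[OF range_intros(1)] by simp
next
  case (pCons c g)
  have "[:pCons c g:] = C2 c + Yv * [:g:]" by (simp add: C2_def Yv_def)
  then have "[:pCons c g:] * u = C2 c * u + Yv * ([:g:] * u)" by (simp only: distrib_right mult.assoc)
  also have "y_span \<dots>"
    by (intro y_span_add y_span_range_mult range_C2 y_span_Yv_mult pCons)
  finally show ?case .
qed

text \<open>Each factor x is paid for by one factor \<open>a\<close>, because a x = f -
  \<theta>(y).\<close>

lemma y_span_denominator: "\<exists>k. y_span (C2 a ^ k * u)"
proof (induction u)
  case 0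
  show ?case using y_span_range[OF range_intros(1)] by simp
next
  case (pCons c u)
  then obtain k where k: "y_span (C2 a ^ k * u)" by blast
  have "pCons c u = [:c:] + Xv * u" by (simp add: Xv_def)
  then have "C2 a ^ Suc k * pCons c u = C2 a ^ Suc k * ([:c:] * 1) + (C2 a * Xv) * (C2 a ^ k * u)"
    by (simp add: algebra_simps)
  also have "C2 a * Xv = f + [:- \<theta>:]" by (simp add: f_eq)
  also have "C2 a ^ Suc k * ([:c:] * 1) + (f + [:- \<theta>:]) * (C2 a ^ k * u)
    = C2 a ^ Suc k * ([:c:] * 1) + (f * (C2 a ^ k * u) + [:- \<theta>:] * (C2 a ^ k * u))"
    by (simp only: distrib_right)
  also have "y_span \<dots>"
    by (intro y_span_add y_span_range_mult y_span_const_mult k range_f)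
      (intro range_intros range_C2 y_span_range)+
  finally show ?case by blast
qed

lemma invariant_y_span:
  assumes "y_span u" "\<phi> u = u"
  shows "u \<in> range \<sigma>'"
proof -
  obtain H where H: "\<And>i. coeff H i \<in> range \<sigma>'" "degree H < p" "u = poly H Yv"
    using assms by (auto simp: y_span_def)
  have fixed: "\<phi> (coeff H i) = coeff H i" for i
    using H(1)[of i] \<phi>_\<sigma>' by auto
  have \<phi>H: "\<phi> (poly H v) = poly H (\<phi> v)" for v
    by (simp add: poly_altdef \<phi>_simps fixed)
  define c where "c = C2 a * F"
  have c: "c \<noteq> 0" using a_nz F_nz by (simp add: c_def C2_eq_0_iff)
  have \<phi>c: "\<phi> c = c" by (simp add: c_def \<phi>_simps \<phi>_C2 \<phi>_F)
  \<comment> \<open>Iterating \<open>\<phi>\<close>, which fixes \<open>u\<close> and the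
    coefficients of \<open>H\<close>, moves the argument along y + j a F.\<close>
  have u: "poly H (Yv + of_nat j * c) = u" for j
  proof (induction j)
    case (Suc j)
    have "\<phi> (Yv + of_nat j * c) = Yv + of_nat (Suc j) * c"
      using \<phi>_Yv[folded c_def] by (simp add: \<phi>_simps \<phi>c algebra_simps)
    then show ?case using \<phi>H[of "Yv + of_nat j * c"] Suc assms(2) by simp
  qed (simp add: H(3))
  have "H - [:u:] = 0"
  proof (rule ccontr)
    assume nz: "H - [:u:] \<noteq> 0"
    let ?r = "\<lambda>j. Yv + of_nat j * c"
    \<comment> \<open>Two of these points coincide only if p divides the difference of their
      indices.\<close>
    have eq: "i = j" if "i \<le> j" "j < p" "?r i = ?r j" for i j
    proof -
      have "of_nat (j - i) * c = 0" using that by (auto simp: of_nat_diff left_diff_distrib)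
      then have "p dvd j - i" using c char_poly(2) by (simp add: of_nat_eq_0_iff_char_dvd)
      then show ?thesis using that by (auto dest: dvd_imp_le)
    qed
    have "inj_on ?r {..<p}"
      by (rule inj_onI) (metis eq lessThan_iff linear)
    then have "p = card (?r ` {..<p})" by (simp add: card_image)
    also have "\<dots> \<le> card {v. poly (H - [:u:]) v = 0}"
      by (intro card_mono poly_roots_finite nz) (auto simp: u)
    also have "\<dots> \<le> degree (H - [:u:])" by (rule card_poly_roots_bound[OF nz])
    also have "\<dots> < p" using H(2) ppos by (intro degree_diff_less) auto
    finally show False by simp
  qed
  then have "coeff H 0 = u" by (metis coeff_pCons_0 eq_iff_diff_eq_0)
  then show ?thesis using H(1)[of 0] by simp
qed

lemma range_\<sigma>': "range \<sigma>' = {u. \<phi> u = u}"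
proof (intro equalityI subsetI)
  fix u assume "u \<in> {u. \<phi> u = u}"
  then have u: "\<phi> u = u" by simp
  obtain k where "y_span (C2 a ^ k * u)" using y_span_denominator by blast
  then have "C2 a ^ k * u \<in> range \<sigma>'"
    by (rule invariant_y_span) (simp add: \<phi>_simps \<phi>_C2 u)
  then show "u \<in> range \<sigma>'"
    using range_\<sigma>'_saturated[of "a ^ k" k u] by (simp add: C2_power)
qed (auto simp: \<phi>_\<sigma>')

section \<open>Return to the original order of the variables\<close>

lemma swap_\<Lambda>':
  "ev3 C3 \<Lambda>' Y2 Y1 Y0 = C3 (b ^ p) * Y2 + ev1 C3 \<rho>p Y0 - Y1 ^ p
     + C3 (b ^ (p - 1)) * ev2 C3 lam Y0 Y1 * ev2 C3 \<nu> Y0 Y1"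
proof -
  note hom = rhom_ev2[OF rhom_C3, of Y1 Y0]
  have "ev3 C3 \<Lambda>' Y2 Y1 Y0 = ev2 C3 (M0 + C2 (b ^ (p - 1)) * ev2 C2 lam Yv Xv * ev2 C2 \<nu> Yv Xv) Y1 Y0
     + Y2 * ev2 C3 (C2 (b ^ p)) Y1 Y0"
    by (simp add: \<Lambda>'_eq ev3_def ev1_pCons ev1_0 rhom_0[OF hom])
  also have "\<dots> = ev1 C3 \<rho>p Y0 - Y1 ^ p + C3 (b ^ (p - 1)) * ev2 C3 lam Y0 Y1 * ev2 C3 \<nu> Y0 Y1
     + Y2 * C3 (b ^ p)"
    by (simp add: M0_def rhom_simps[OF hom] ev2_C2[OF rhom_C3] ev2_Xv[OF rhom_C3] ev2_const[OF rhom_C3]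
        ev2_swap[OF rhom_C3])
  also have "\<dots> = C3 (b ^ p) * Y2 + (ev1 C3 \<rho>p Y0 - Y1 ^ p + C3 (b ^ (p - 1)) * ev2 C3 lam Y0 Y1 * ev2 C3 \<nu> Y0 Y1)"
    by (subst mult.commute[of Y2]) (rule add.commute)
  finally show ?thesis by (simp only: add_diff_eq add.assoc[symmetric])
qed

text \<open>Reversing the variables is an involutive ring homomorphism, so it carries the kernel
  generator and leaves the image unchanged.\<close>

lemma kernel_and_range:
  defines "\<sigma> \<equiv> \<lambda>g. ev3 C2 g q q1 q2"
    and "\<Lambda> \<equiv> C3 (b ^ p) * Y2 + ev1 C3 \<rho>p Y0 - Y1 ^ p
             + C3 (b ^ (p - 1)) * ev2 C3 lam Y0 Y1 * ev2 C3 \<nu> Y0 Y1"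
  shows "{g. \<sigma> g = 0} = {\<Lambda> * h | h. True} \<and> range \<sigma> = {u. \<phi> u = u}"
proof -
  define s :: "'a poly poly poly \<Rightarrow> 'a poly poly poly" where "s g = ev3 C3 g Y2 Y1 Y0" for g
  have s: "rhom s" unfolding s_def by (rule rhom_ev3[OF rhom_C3])
  have ss: "s (s g) = g" for g by (simp add: s_def ev3_swap_swap)
  have \<sigma>: "\<sigma> g = \<sigma>' (s g)" for g
    by (simp add: \<sigma>_def \<sigma>'_def s_def ev3_swap[OF rhom_C2])
  have \<Lambda>: "s \<Lambda>' = \<Lambda>" by (simp add: s_def \<Lambda>_def swap_\<Lambda>')
  have "\<sigma> g = 0 \<longleftrightarrow> \<Lambda> dvd g" for g
    using rhom_dvd[OF s, of \<Lambda>' "s g"] rhom_dvd[OF s, of \<Lambda> g] ss[of g] ss[of \<Lambda>']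
    by (auto simp: \<sigma> kernel_\<sigma>' \<Lambda>)
  moreover have "range \<sigma> = \<sigma>' ` range s"
    by (simp add: \<sigma> image_image)
  moreover have "range s = UNIV"
    by (rule surjI) (rule ss)
  ultimately show ?thesis
    by (auto simp: range_\<sigma>' dvd_def)
qed

end

text \<open>The algebra isomorphism is expressed through the kernel and the surjectivity of \<sigma>
  onto the invariants, from which it follows by the first isomorphism theorem.\<close>

theorem theorem6p18:
  fixes p :: nat
    and a d :: "'a::factorial_ring_gcd"
    and \<theta> :: "'a poly"
    and F :: "'a poly poly"
    and lam \<nu> :: "'a poly poly"
  assumes charp: "CHAR('a) = p" and ppos: "p > 0"
    and a_nz: "a \<noteq> 0"
    and theta_nz: "\<theta> \<noteq> 0" and theta_0: "coeff \<theta> 0 = 0"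
    and F_nz: "F \<noteq> 0"
    and F_in: "\<exists>G :: 'a poly. F = ev1 C2 G (C2 a * Xv + ev1 C2 \<theta> Yv)"
    and d_dvd1: "[:d:] dvd [:a:]" and d_dvd2: "[:d:] dvd pderiv \<theta>"
    and d_gcd: "\<forall>e. e dvd [:a:] \<longrightarrow> e dvd pderiv \<theta> \<longrightarrow> e dvd [:d:]"
    and lambda_eq: "ev2 (\<lambda>c. [:c:]) lam (monom 1 p)
        (\<Sum>i\<le>degree \<theta>. if p dvd i then 0 else monom (coeff \<theta> i div d) i)
      = (pderiv (\<Sum>i\<le>degree \<theta>. if p dvd i then 0 else monom (coeff \<theta> i div d) i)) ^ p * [:0, 1:]"
    and nu_eq:
      "let f = C2 a * Xv + ev1 C2 \<theta> Yv;
           \<theta>s = (\<Sum>i\<in>{1..degree \<theta>}. monom (coeff \<theta> (p * i)) i);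
           q = Yv ^ p - (C2 a * F) ^ (p - 1) * Yv;
           q1 = divR d (f - ev1 C2 \<theta>s q)
       in (C2 d * F) ^ (p - 1) = ev2 C2 \<nu> q q1"
  shows
    "let b = a div d;
         f = C2 a * Xv + ev1 C2 \<theta> Yv;
         \<rho> = (\<Sum>i\<le>degree \<theta>. if p dvd i then 0 else monom (coeff \<theta> i div d) i);
         \<rho>p = (\<Sum>i\<le>degree \<theta>. if p dvd i then 0 else monom ((coeff \<theta> i div d) ^ p) i);
         \<theta>s = (\<Sum>i\<in>{1..degree \<theta>}. monom (coeff \<theta> (p * i)) i);
         \<phi>y = Yv + C2 a * F;
         \<phi>x = Xv + divR a (ev1 C2 \<theta> Yv - ev1 C2 \<theta> (Yv + C2 a * F));
         \<phi> = (\<lambda>u. ev2 C2 u \<phi>x \<phi>y);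
         q = Yv ^ p - (C2 a * F) ^ (p - 1) * Yv;
         q1 = divR d (f - ev1 C2 \<theta>s q);
         q1t = divR (b ^ (p - 1)) (q1 ^ p - ev1 C2 \<rho>p q);
         q2 = divR b (q1t - ev2 C2 lam q q1 * (C2 d * F) ^ (p - 1));
         \<sigma> = (\<lambda>g. ev3 C2 g q q1 q2);
         \<Lambda> = C3 (b ^ p) * Y2 + ev1 C3 \<rho>p Y0 - Y1 ^ p
             + C3 (b ^ (p - 1)) * ev2 C3 lam Y0 Y1 * ev2 C3 \<nu> Y0 Y1
     in {g. \<sigma> g = 0} = {\<Lambda> * h | h. True} \<and> range \<sigma> = {u. \<phi> u = u}"
proof -
  obtain G where G: "F = ev1 C2 G (C2 a * Xv + ev1 C2 \<theta> Yv)" using F_in by blast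
  have b: "a = a div d * d" using d_dvd1 by simp
  interpret cyclic_action p a "a div d" d \<theta> G F lam \<nu>
    using charp ppos a_nz theta_0 F_nz G b d_dvd2 d_gcd by unfold_locales auto
  interpret cyclic_action_lambda p a "a div d" d \<theta> G F lam \<nu>
    using lambda_eq nu_eq
    by unfold_locales
      (simp_all only: \<rho>_def w_def q_def q1_def f_def \<theta>s_def Let_def)
  show ?thesis
    using kernel_and_range
    unfolding Let_def \<phi>_def \<phi>x_def \<phi>y_def q2_def q1t_def q1_def q_def f_def \<theta>s_def \<rho>p_def w_def .
qed

end
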